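(* Let $a,b\in C^2(\mathbb{R})$ be real-valued with $b_0:=\inf_{z\in\mathbb{R}}b(z)>0$ and $b,\partial_za,\partial_zb,\partial_z^2a,\partial_z^2b\in L^\infty(\mathbb{R})$. Then there exists a constant $\mathscr{C}>0$ such that all normalized solutions $y(x,z,t)=(u,v,w)^T$ of the system $$\partial_tu=-a(z)\partial_xu+b(z)\partial_x^2u,$$ $$\partial_tv=-(\partial_za(z))\partial_xu+(\partial_zb(z))\partial_x^2u-a(z)\partial_xv+b(z)\partial_x^2v,$$ $$\partial_tw=-(\partial_z^2a(z))\partial_xu+(\partial_z^2b(z))\partial_x^2u-2(\partial_za(z))\partial_xv+2(\partial_zb(z))\partial_x^2v-a(z)\partial_xw+b(z)\partial_x^2w,$$ with $x\in\mathbb{T}^1$, $z\in\mathbb{R}$, $t\ge0$, and with steady state $y^\infty:=(1,0,0)^T$, satisfy $$\sup_{z\in\mathbb{R}}\|y(\cdot,z,t)-y^\infty\|^2_{L^2(0,2\pi;\mathbb{R}^3)}\le\mathscr{C}(1+t^4)e^{-2b_0t}\sup_{z\in\mathbb{R}}\|y(\cdot,z,0)-y^\infty\|^2_{L^2(0,2\pi;\mathbb{R}^3)},\qquad t\ge 0.$$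
   Context: $\mathbb{T}^1$ is the one-dimensional torus of length $2\pi$. Here $u(x,z,t)\in\mathbb{R}$ solves the first equation with initial datum $u(x,z,0)=u^0(x,z)$, where $z\in\mathbb{R}$ is a parameter, and $v:=\partial_zu$, $w:=\partial_z^2u$ are its parameter derivatives, solving the second and third equations. "Normalized" means $\frac1{2\pi}\int_0^{2\pi}u^0(x,z)\,dx=1$ for all $z\in\mathbb{R}$, and consequently the initial data of $v$ and $w$ satisfy $\int_0^{2\pi}v(x,z,0)\,dx=\int_0^{2\pi}w(x,z,0)\,dx=0$ for all $z\in\mathbb{R}$. The constant $\mathscr{C}$ is independent of the solution, of $z$ and of $t$. *)

theory Defs
  imports "HOL-Analysis.Analysis"
begin

definition C2 :: "(real \<Rightarrow> real) \<Rightarrow> bool" where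
  "C2 f \<longleftrightarrow> (\<forall>z. f differentiable at z) \<and> (\<forall>z. deriv f differentiable at z) \<and>
     continuous_on UNIV (deriv (deriv f))"

definition in_Linfty :: "(real \<Rightarrow> real) \<Rightarrow> bool" where
  "in_Linfty f \<longleftrightarrow> f \<in> borel_measurable lebesgue \<and> (\<exists>M. AE z in lebesgue. \<bar>f z\<bar> \<le> M)"

text \<open>
  Functions on the torus of length \<open>2 * pi\<close> are represented by functions on the real line
  of which only the restriction to the open interval from \<open>0\<close> to \<open>2 * pi\<close> matters.
\<close>

abbreviation torus :: "real measure" where
  "torus \<equiv> lebesgue_on {0<..<2 * pi}"

definition in_L2 :: "(real \<Rightarrow> real) \<Rightarrow> bool" where
  "in_L2 f \<longleftrightarrow> f \<in> borel_measurable torus \<and> integrable torus (\<lambda>x. (f x)\<^sup>2)"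

definition L2norm_sq :: "(real \<Rightarrow> real ^ 3) \<Rightarrow> ennreal" where
  "L2norm_sq f = (\<integral>\<^sup>+x. ennreal ((norm (f x))\<^sup>2) \<partial>torus)"

definition pairing :: "(real \<Rightarrow> real) \<Rightarrow> (real \<Rightarrow> real) \<Rightarrow> real" where
  "pairing f \<phi> = (\<integral>x. f x * \<phi> x \<partial>torus)"

definition test_function :: "(real \<Rightarrow> real) \<Rightarrow> bool" where
  "test_function \<phi> \<longleftrightarrow> (\<forall>x. \<phi> (x + 2 * pi) = \<phi> x) \<and>
     (\<forall>n x. (deriv ^^ n) \<phi> differentiable at x)"

text \<open>
  The distribution \<open>- \<alpha> \<partial>\<^sub>x f + \<beta> \<partial>\<^sub>x\<^sup>2 f\<close> on the torus, applied to a test function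
  (both \<open>x\<close>-derivatives are moved to \<open>\<phi>\<close> by integration by parts; there are no boundary
  terms because \<open>\<phi>\<close> is periodic).
\<close>

definition conv_diff :: "real \<Rightarrow> real \<Rightarrow> (real \<Rightarrow> real) \<Rightarrow> (real \<Rightarrow> real) \<Rightarrow> real" where
  "conv_diff \<alpha> \<beta> f \<phi> = \<alpha> * pairing f (deriv \<phi>) + \<beta> * pairing f (deriv (deriv \<phi>))"

text \<open>
  The equation \<open>\<partial>\<^sub>t f = R\<close> for \<open>t > 0\<close> in the sense of distributions in \<open>x\<close>, for a curve
  \<open>t \<mapsto> f t\<close> that attains its value at \<open>t = 0\<close> continuously in the same sense.
\<close>

definition evolves_by ::
  "(real \<Rightarrow> real \<Rightarrow> real) \<Rightarrow> (real \<Rightarrow> (real \<Rightarrow> real) \<Rightarrow> real) \<Rightarrow> bool" where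
  "evolves_by f R \<longleftrightarrow> (\<forall>\<phi>. test_function \<phi> \<longrightarrow>
     continuous_on {0..} (\<lambda>t. pairing (f t) \<phi>) \<and>
     (\<forall>t>0. ((\<lambda>t. pairing (f t) \<phi>) has_real_derivative R t \<phi>) (at t)))"

text \<open>
  Solutions with values in \<open>L\<^sup>2\<close>, for arbitrary initial data in \<open>L\<^sup>2\<close>. Arguments are in
  the order \<open>x\<close>, \<open>z\<close>, \<open>t\<close>. Classical and mild solutions are solutions in this sense.
\<close>

definition solves_system ::
  "(real \<Rightarrow> real) \<Rightarrow> (real \<Rightarrow> real) \<Rightarrow>
   (real \<Rightarrow> real \<Rightarrow> real \<Rightarrow> real) \<Rightarrow> (real \<Rightarrow> real \<Rightarrow> real \<Rightarrow> real) \<Rightarrow>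
   (real \<Rightarrow> real \<Rightarrow> real \<Rightarrow> real) \<Rightarrow> bool" where
  "solves_system a b u v w \<longleftrightarrow>
     (\<forall>z. \<forall>t\<ge>0. in_L2 (\<lambda>x. u x z t) \<and> in_L2 (\<lambda>x. v x z t) \<and> in_L2 (\<lambda>x. w x z t)) \<and>
     (\<forall>z. evolves_by (\<lambda>t x. u x z t)
        (\<lambda>t \<phi>. conv_diff (a z) (b z) (\<lambda>x. u x z t) \<phi>)) \<and>
     (\<forall>z. evolves_by (\<lambda>t x. v x z t)
        (\<lambda>t \<phi>. conv_diff (deriv a z) (deriv b z) (\<lambda>x. u x z t) \<phi>
             + conv_diff (a z) (b z) (\<lambda>x. v x z t) \<phi>)) \<and>
     (\<forall>z. evolves_by (\<lambda>t x. w x z t)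
        (\<lambda>t \<phi>. conv_diff (deriv (deriv a) z) (deriv (deriv b) z) (\<lambda>x. u x z t) \<phi>
             + conv_diff (2 * deriv a z) (2 * deriv b z) (\<lambda>x. v x z t) \<phi>
             + conv_diff (a z) (b z) (\<lambda>x. w x z t) \<phi>))"

definition normalized ::
  "(real \<Rightarrow> real \<Rightarrow> real \<Rightarrow> real) \<Rightarrow> (real \<Rightarrow> real \<Rightarrow> real \<Rightarrow> real) \<Rightarrow>
   (real \<Rightarrow> real \<Rightarrow> real \<Rightarrow> real) \<Rightarrow> bool" where
  "normalized u v w \<longleftrightarrow> (\<forall>z.
     1 / (2 * pi) * (\<integral>x. u x z 0 \<partial>torus) = 1 \<and>
     (\<integral>x. v x z 0 \<partial>torus) = 0 \<and> (\<integral>x. w x z 0 \<partial>torus) = 0)"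

text \<open>
  The conditions on \<open>v\<close> and \<open>w\<close> in \<open>normalized\<close> are automatic when \<open>v\<close> and \<open>w\<close> are the
  first and second parameter derivatives of \<open>u\<close>, even if \<open>\<partial>\<^sub>z\<close> is only understood in the
  sense of distributions in \<open>x\<close>. Nothing else about this relation is needed below, so
  \<open>v\<close> and \<open>w\<close> are unknowns of the system in their own right.
\<close>

definition param_deriv ::
  "(real \<Rightarrow> real \<Rightarrow> real \<Rightarrow> real) \<Rightarrow> (real \<Rightarrow> real \<Rightarrow> real \<Rightarrow> real) \<Rightarrow> bool" where
  "param_deriv f g \<longleftrightarrow> (\<forall>\<phi>. test_function \<phi> \<longrightarrow> (\<forall>z. \<forall>t\<ge>0.
     ((\<lambda>z. pairing (\<lambda>x. f x z t) \<phi>) has_real_derivative pairing (\<lambda>x. g x z t) \<phi>) (at z)))"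

lemma test_function_one: "test_function (\<lambda>x. 1)"
proof -
  have "(deriv ^^ n) (\<lambda>x::real. 1::real) = (\<lambda>x. if n = 0 then 1 else 0)" for n
    by (induction n) auto
  then show ?thesis
    by (simp add: test_function_def)
qed

lemma param_deriv_mean_zero:
  assumes "param_deriv f g" and "\<And>z. (\<integral>x. f x z 0 \<partial>torus) = c"
  shows "(\<integral>x. g x z 0 \<partial>torus) = 0"
proof -
  have "((\<lambda>z. \<integral>x. f x z 0 \<partial>torus) has_real_derivative (\<integral>x. g x z 0 \<partial>torus)) (at z)"
    using assms(1) test_function_one unfolding param_deriv_def pairing_def by fastforce
  then have "((\<lambda>z::real. c) has_real_derivative (\<integral>x. g x z 0 \<partial>torus)) (at z)"
    by (simp only: assms(2))
  then show ?thesis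
    using DERIV_const DERIV_unique by blast
qed

lemma normalized_if_param_deriv:
  assumes "param_deriv u v" and "param_deriv v w"
    and mean: "\<And>z. 1 / (2 * pi) * (\<integral>x. u x z 0 \<partial>torus) = 1"
  shows "normalized u v w"
proof -
  have "(\<integral>x. u x z 0 \<partial>torus) = 2 * pi" for z
    using mean[of z] by (simp add: field_simps)
  then have v: "(\<integral>x. v x z 0 \<partial>torus) = 0" for z
    by (rule param_deriv_mean_zero[OF assms(1)])
  have "(\<integral>x. w x z 0 \<partial>torus) = 0" for z
    by (rule param_deriv_mean_zero[OF assms(2) v])
  with mean v show ?thesis
    by (simp add: normalized_def)
qed

end

theory Submission
  imports Defs
begin

text \<open>
  The equations decouple over Fourier modes. In mode \<open>k\<close> the system is triangular with the single
  eigenvalue \<open>\<lambda> = - b k\<^sup>2 + i a k\<close>, and it is solved by \<open>exp (\<lambda> t)\<close> times a polynomial in \<open>t\<close> whose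
  coefficients involve the \<open>z\<close>-derivatives of \<open>\<lambda>\<close>, of size \<open>k\<^sup>2\<close>. The modes \<open>\<bar>k\<bar> \<ge> 2\<close> decay faster
  than \<open>exp (- b\<^sub>0 t)\<close>, which absorbs these powers of \<open>k\<close>, so every mode is bounded by
  \<open>const (1 + t)\<^sup>2 exp (- b\<^sub>0 t)\<close>; mode \<open>0\<close> of \<open>y - y\<^sup>\<infinity>\<close> vanishes by normalization.
  Parseval's identity sums the modes.
\<close>

section \<open>Trigonometric polynomials\<close>

text \<open>The data are merely square-integrable and the equations hold only against test
  functions, so no \<open>x\<close>-derivative of a solution is available. Cosines and sines are
  themselves test functions: testing with them gives exact linear ODEs for each mode, with no
  regularity to establish. The price is completeness of the trigonometric system for arbitrary
  square-integrable functions, which is derived from Stone-Weierstrass on the unit circle. No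
  equation couples different values of \<open>z\<close>, so each \<open>z\<close> is estimated
  separately, with constants that depend only on \<open>b0\<close> and on bounds for the first two
  derivatives of \<open>a\<close> and \<open>b\<close>; \<open>a z\<close> itself enters only as a
  phase. The power \<open>t ^ 4\<close> comes from differentiating \<open>exp (t \<lambda>)\<close>
  twice in \<open>z\<close>, which produces \<open>(t \<lambda>')\<^sup>2\<close>, and from squaring
  the norm. In mode 1 no surplus decay is guaranteed that could absorb this growth.\<close>

definition trig :: "int \<Rightarrow> real \<Rightarrow> real" where
  "trig k x = (if 0 \<le> k then cos (of_int k * x) else sin (of_int k * x))"

text \<open>The square of the \<open>L2\<close> norm of \<open>trig k\<close>. Sines sit at the
  negative indices, so one integer index runs through the whole orthogonal system and the zero
  function never occurs in it.\<close>

definition trig_norm_sq :: "int \<Rightarrow> real" where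
  "trig_norm_sq k = (if k = 0 then 2 * pi else pi)"

definition trig_poly :: "(real \<Rightarrow> real) \<Rightarrow> bool" where
  "trig_poly f \<longleftrightarrow> (\<exists>S c. finite S \<and> f = (\<lambda>x. \<Sum>k\<in>S. c k * trig k x))"

section \<open>Square-integrable functions on the torus\<close>

lemma finite_measure_torus: "finite_measure torus"
  by (rule finite_measure_lebesgue_on) simp

lemma measurable_torus_continuous:
  "continuous_on UNIV f \<Longrightarrow> f \<in> borel_measurable torus" for f :: "real \<Rightarrow> real"
  by (intro continuous_imp_measurable_on_sets_lebesgue) (auto intro: continuous_on_subset)

lemma in_L2_bounded:
  assumes "f \<in> borel_measurable torus" "\<And>x. x \<in> {0<..<2 * pi} \<Longrightarrow> \<bar>f x\<bar> \<le> B"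
  shows "in_L2 f"
proof -
  interpret finite_measure torus by (rule finite_measure_torus)
  have "AE x in torus. norm ((f x)\<^sup>2) \<le> B\<^sup>2"
    using power_mono[OF assms(2) abs_ge_zero, of _ 2] by (intro AE_I2) simp
  with assms(1) show ?thesis
    unfolding in_L2_def by (auto intro!: integrable_const_bound[where B = "B\<^sup>2"])
qed

lemma integrable_mult_L2:
  assumes "in_L2 f" "in_L2 g"
  shows "integrable torus (\<lambda>x. f x * g x)"
proof (rule Bochner_Integration.integrable_bound)
  show "integrable torus (\<lambda>x. (f x)\<^sup>2 + (g x)\<^sup>2)"
    using assms by (auto simp: in_L2_def)
  show "(\<lambda>x. f x * g x) \<in> borel_measurable torus"
    using assms by (auto simp: in_L2_def)
  have "\<bar>a * b\<bar> \<le> a\<^sup>2 + b\<^sup>2" for a b :: real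
    by (rule abs_leI; use sum_squares_ge_zero[of a b] zero_le_power2[of "a - b"] zero_le_power2[of "a + b"]
        in \<open>simp add: power2_eq_square algebra_simps\<close>)
  then show "AE x in torus. norm (f x * g x) \<le> norm ((f x)\<^sup>2 + (g x)\<^sup>2)"
    by simp
qed

lemma in_L2_add:
  assumes "in_L2 f" "in_L2 g"
  shows "in_L2 (\<lambda>x. f x + g x)"
  using assms integrable_mult_L2[OF assms] unfolding in_L2_def
  by (auto simp: power2_sum intro!: borel_measurable_add Bochner_Integration.integrable_add
      integrable_mult_right simp: mult.assoc)

lemma in_L2_cmult: "in_L2 f \<Longrightarrow> in_L2 (\<lambda>x. c * f x)"
  unfolding in_L2_def by (auto simp: power_mult_distrib)

lemma in_L2_diff:
  assumes "in_L2 f" "in_L2 g"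
  shows "in_L2 (\<lambda>x. f x - g x)"
  using in_L2_add[OF assms(1) in_L2_cmult[OF assms(2), of "- 1"]] by simp

lemma continuous_on_trig [continuous_intros]: "continuous_on A (trig k)"
  unfolding trig_def by (cases "0 \<le> k") (auto intro!: continuous_intros)

lemma in_L2_trig: "in_L2 (trig k)"
  by (rule in_L2_bounded[where B = 1]) (auto simp: trig_def intro!: measurable_torus_continuous continuous_on_trig)

lemma in_L2_one: "in_L2 (\<lambda>x. 1)"
  by (rule in_L2_bounded[where B = 1]) auto

lemma in_L2_sum_trig: "in_L2 (\<lambda>x. \<Sum>k\<in>S. c k * trig k x)"
proof (induction S rule: infinite_finite_induct)
  case (insert k S)
  then show ?case
    using in_L2_add[OF in_L2_cmult[OF in_L2_trig[of k], of "c k"]] by simp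
qed (use in_L2_cmult[OF in_L2_one, of 0] in auto)

lemma trig_poly_L2: "trig_poly f \<Longrightarrow> in_L2 f"
  unfolding trig_poly_def using in_L2_sum_trig by auto

section \<open>Orthogonality of the trigonometric system\<close>

lemma integral_torus_FTC:
  assumes "\<And>x. (F has_real_derivative f x) (at x)" "continuous_on UNIV f"
  shows "(\<integral>x. f x \<partial>torus) = F (2 * pi) - F 0"
proof -
  have "f integrable_on {0..2 * pi}"
    using assms(2) by (intro integrable_continuous_real continuous_on_subset[OF assms(2)]) auto
  have "bounded (f ` {0..2 * pi})"
    using assms(2) by (intro compact_imp_bounded compact_continuous_image continuous_on_subset[OF assms(2)]) auto
  then obtain B where B: "\<And>x. x \<in> {0..2 * pi} \<Longrightarrow> \<bar>f x\<bar> \<le> B"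
    by (auto simp: bounded_iff simp del: atLeastAtMost_iff)
  interpret finite_measure torus by (rule finite_measure_torus)
  have "integrable torus f"
    using B by (intro integrable_const_bound[where B = B] AE_I2 measurable_torus_continuous assms(2)) auto
  then have "(\<integral>x. f x \<partial>torus) = integral {0..2 * pi} f"
    by (simp add: lebesgue_integral_eq_integral integral_open_interval_real)
  also have "\<dots> = F (2 * pi) - F 0"
    using assms(1) by (intro integral_unique fundamental_theorem_of_calculus)
      (auto simp: has_real_derivative_iff_has_vector_derivative[symmetric] intro: has_field_derivative_at_within)
  finally show ?thesis .
qed

lemma integral_cos_torus:
  "(\<integral>x. cos (of_int m * x) \<partial>torus) = (if m = 0 then 2 * pi else 0)"
proof (cases "m = 0")
  case True
  then show ?thesis
    using integral_torus_FTC[of "\<lambda>x. x" "\<lambda>x. 1"] by simp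
next
  case False
  have "(\<integral>x. cos (of_int m * x) \<partial>torus) = sin (of_int m * (2 * pi)) / m - sin (of_int m * 0) / m"
    by (rule integral_torus_FTC[where F = "\<lambda>x. sin (of_int m * x) / m"])
      (use False in \<open>auto intro!: derivative_eq_intros continuous_intros\<close>)
  moreover have "sin (of_int m * (2 * pi)) = 0"
    using sin_int_2pin[of m] by (simp add: mult_ac)
  ultimately show ?thesis
    using False by simp
qed

lemma integral_sin_torus: "(\<integral>x. sin (of_int m * x) \<partial>torus) = 0"
proof (cases "m = 0")
  case False
  have "(\<integral>x. sin (of_int m * x) \<partial>torus) = - cos (of_int m * (2 * pi)) / m - (- cos (of_int m * 0) / m)"
    by (rule integral_torus_FTC[where F = "\<lambda>x. - cos (of_int m * x) / m"])
      (use False in \<open>auto intro!: derivative_eq_intros continuous_intros\<close>)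
  moreover have "cos (of_int m * (2 * pi)) = 1"
    using cos_int_2pin[of m] by (simp add: mult_ac)
  ultimately show ?thesis
    by simp
qed simp

lemma integrable_cos_torus: "integrable torus (\<lambda>x. cos (of_int m * x))"
  and integrable_sin_torus: "integrable torus (\<lambda>x. sin (of_int m * x))"
proof -
  interpret finite_measure torus by (rule finite_measure_torus)
  show "integrable torus (\<lambda>x. cos (of_int m * x))" "integrable torus (\<lambda>x. sin (of_int m * x))"
    by (intro integrable_const_bound[where B = 1] AE_I2 measurable_torus_continuous continuous_intros; simp)+
qed

text \<open>The product-to-sum formulas serve twice: they reduce orthogonality to integrals of a
  single cosine or sine, and they make trigonometric polynomials an algebra.\<close>

lemma trig_mult:
  "trig j x * trig k x =
    (if 0 \<le> j then
       if 0 \<le> k then (cos (of_int (j - k) * x) + cos (of_int (j + k) * x)) / 2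
       else (sin (of_int (j + k) * x) - sin (of_int (j - k) * x)) / 2
     else
       if 0 \<le> k then (sin (of_int (j + k) * x) + sin (of_int (j - k) * x)) / 2
       else (cos (of_int (j - k) * x) - cos (of_int (j + k) * x)) / 2)"
  by (simp add: trig_def cos_times_cos cos_times_sin sin_times_cos sin_times_sin distrib_right left_diff_distrib)

lemma pairing_trig_trig: "pairing (trig j) (trig k) = (if j = k then trig_norm_sq k else 0)"
proof -
  note [simp] = integral_cos_torus integral_sin_torus integrable_cos_torus integrable_sin_torus
  \<comment> \<open>The frequencies \<open>j - k\<close> and \<open>j + k\<close> must stay single
    integers under \<open>of_int\<close> for the integral formulas to match.\<close>
  note [simp del] = of_int_add of_int_diff mult_cancel_right1
  show ?thesis
    unfolding pairing_def trig_mult trig_norm_sq_def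
    by (cases "0 \<le> j"; cases "0 \<le> k") auto
qed

section \<open>The algebra of trigonometric polynomials\<close>

lemma trig_poly_add:
  assumes "trig_poly f" "trig_poly g"
  shows "trig_poly (\<lambda>x. f x + g x)"
proof -
  obtain S c where S: "finite S" "f = (\<lambda>x. \<Sum>k\<in>S. c k * trig k x)"
    using assms(1) by (auto simp: trig_poly_def)
  obtain T d where T: "finite T" "g = (\<lambda>x. \<Sum>k\<in>T. d k * trig k x)"
    using assms(2) by (auto simp: trig_poly_def)
  have "(\<Sum>k\<in>S. c k * trig k x) = (\<Sum>k\<in>S \<union> T. (if k \<in> S then c k else 0) * trig k x)" for x
    using S(1) T(1) by (intro sum.mono_neutral_cong_left) auto
  moreover have "(\<Sum>k\<in>T. d k * trig k x) = (\<Sum>k\<in>S \<union> T. (if k \<in> T then d k else 0) * trig k x)" for x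
    using S(1) T(1) by (intro sum.mono_neutral_cong_left) auto
  ultimately have "f x + g x =
      (\<Sum>k\<in>S \<union> T. ((if k \<in> S then c k else 0) + (if k \<in> T then d k else 0)) * trig k x)" for x
    unfolding S(2) T(2) distrib_right sum.distrib by (rule arg_cong2)
  then show ?thesis
    unfolding trig_poly_def fun_eq_iff using finite_UnI[OF S(1) T(1)] by (intro exI conjI allI)
qed

lemma trig_poly_cmult:
  assumes "trig_poly f"
  shows "trig_poly (\<lambda>x. a * f x)"
proof -
  obtain S c where S: "finite S" "f = (\<lambda>x. \<Sum>k\<in>S. c k * trig k x)"
    using assms by (auto simp: trig_poly_def)
  have "a * f x = (\<Sum>k\<in>S. (a * c k) * trig k x)" for x
    by (simp add: S(2) sum_distrib_left mult.assoc)
  then show ?thesis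
    unfolding trig_poly_def fun_eq_iff using S(1) by (intro exI conjI allI)
qed

lemma trig_poly_sum:
  "(\<And>i. i \<in> I \<Longrightarrow> trig_poly (f i)) \<Longrightarrow> trig_poly (\<lambda>x. \<Sum>i\<in>I. f i x)"
proof (induction I rule: infinite_finite_induct)
  case (insert i I)
  then show ?case
    using trig_poly_add[of "f i" "\<lambda>x. \<Sum>i\<in>I. f i x"] by simp
qed (auto simp: trig_poly_def intro!: exI[of _ "{}"])

lemma trig_poly_trig: "trig_poly (trig k)"
  unfolding trig_poly_def by (intro exI[of _ "{k}"] exI[of _ "\<lambda>_. 1"]) auto

lemma trig_poly_cos: "trig_poly (\<lambda>x. cos (of_int m * x))"
  and trig_poly_sin: "trig_poly (\<lambda>x. sin (of_int m * x))"
proof -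
  have "trig \<bar>m\<bar> = (\<lambda>x. cos (of_int m * x))"
    by (cases "0 \<le> m") (auto simp: trig_def fun_eq_iff)
  then show "trig_poly (\<lambda>x. cos (of_int m * x))"
    using trig_poly_trig[of "\<bar>m\<bar>"] by simp
  \<comment> \<open>The minus sign undoes the negative index of the sine; for \<open>m = 0\<close>,
    where \<open>trig 0\<close> is the constant 1, the factor \<open>sgn m\<close> vanishes.\<close>
  have "(\<lambda>x. - sgn m * trig (- \<bar>m\<bar>) x) = (\<lambda>x. sin (of_int m * x))"
    by (cases "m = 0"; cases "0 < m") (auto simp: trig_def fun_eq_iff sgn_if)
  then show "trig_poly (\<lambda>x. sin (of_int m * x))"
    using trig_poly_cmult[OF trig_poly_trig[of "- \<bar>m\<bar>"], of "- sgn m"] by simp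
qed

lemma trig_poly_const: "trig_poly (\<lambda>x. a)"
  using trig_poly_cmult[OF trig_poly_cos[of 0], of a] by simp

lemma trig_poly_trig_mult: "trig_poly (\<lambda>x. trig j x * trig k x)"
proof -
  have "trig_poly (\<lambda>x. s * f x + t * g x)" if "trig_poly f" "trig_poly g" for f g s t
    using that by (intro trig_poly_add trig_poly_cmult)
  note * = this[of _ _ "1/2" "1/2"] this[of _ _ "1/2" "- 1/2"]
  show ?thesis
    unfolding trig_mult
    using *[OF trig_poly_cos[of "j - k"] trig_poly_cos[of "j + k"]]
      *[OF trig_poly_sin[of "j + k"] trig_poly_sin[of "j - k"]]
    by (cases "0 \<le> j"; cases "0 \<le> k")
      (simp_all add: add_divide_distrib diff_divide_distrib del: of_int_add of_int_diff)
qed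

lemma trig_poly_mult:
  assumes "trig_poly f" "trig_poly g"
  shows "trig_poly (\<lambda>x. f x * g x)"
proof -
  obtain S c where S: "f = (\<lambda>x. \<Sum>k\<in>S. c k * trig k x)"
    using assms(1) by (auto simp: trig_poly_def)
  obtain T d where T: "g = (\<lambda>x. \<Sum>k\<in>T. d k * trig k x)"
    using assms(2) by (auto simp: trig_poly_def)
  have "f x * g x = (\<Sum>j\<in>S. \<Sum>k\<in>T. c j * d k * (trig j x * trig k x))" for x
    unfolding S T sum_product by (simp add: mult_ac)
  then show ?thesis
    by (simp add: trig_poly_sum trig_poly_cmult trig_poly_trig_mult)
qed

text \<open>Real-linear functionals of \<open>cis x\<close> are combinations of \<open>cos x\<close>
  and \<open>sin x\<close>, and the algebra structure does the rest. This pulls polynomial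
  approximation on the circle back to the torus.\<close>

lemma trig_poly_real_polynomial_cis:
  "real_polynomial_function p \<Longrightarrow> trig_poly (\<lambda>x. p (cis x))" for p :: "complex \<Rightarrow> real"
proof (induction rule: real_polynomial_function.induct)
  case (linear f)
  interpret bounded_linear f by fact
  have "f (cis x) = f 1 * cos x + f \<i> * sin x" for x
  proof -
    have "cis x = cos x *\<^sub>R 1 + sin x *\<^sub>R \<i>"
      by (simp add: complex_eq_iff)
    then show ?thesis
      by (simp only: add scaleR) simp
  qed
  then show ?case
    using trig_poly_cos[of 1] trig_poly_sin[of 1] by (simp add: trig_poly_add trig_poly_cmult)
qed (auto intro: trig_poly_const trig_poly_add trig_poly_mult)

section \<open>Parseval's identity\<close>

text \<open>The factor \<open>min 1 (m * cmod (z - 1))\<close> removes the jump of \<open>Arg2pi\<close> at \<open>1\<close> and tends to \<open>1\<close> elsewhere.\<close>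

lemma continuous_on_circle_cutoff:
  fixes g :: "real \<Rightarrow> real"
  assumes "continuous_on UNIV g" "\<And>x. \<bar>g x\<bar> \<le> B"
  shows "continuous_on (sphere 0 1) (\<lambda>z. g (Arg2pi z) * min 1 (m * cmod (z - 1)))"
proof (rule continuous_at_imp_continuous_on, rule ballI)
  fix z :: complex assume z: "z \<in> sphere 0 1"
  show "isCont (\<lambda>z. g (Arg2pi z) * min 1 (m * cmod (z - 1))) z"
  proof (cases "z = 1")
    case False
    then have "z \<notin> \<real>\<^sub>\<ge>\<^sub>0"
      using z by (auto simp: complex_nonneg_Reals_iff complex_eq_iff cmod_eq_Re)
    then have "isCont Arg2pi z"
      by (rule continuous_at_Arg2pi)
    moreover have "isCont g (Arg2pi z)"
      using assms(1) by (simp add: continuous_on_eq_continuous_at)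
    ultimately have "isCont (\<lambda>z. g (Arg2pi z)) z"
      by (rule isCont_o2)
    then show ?thesis
      by (intro continuous_intros)
  next
    case True
    have "isCont (\<lambda>z. B * \<bar>min 1 (m * cmod (z - 1))\<bar>) (1 :: complex)"
      by (intro continuous_intros)
    then have lim: "((\<lambda>z. B * \<bar>min 1 (m * cmod (z - 1))\<bar>) \<longlongrightarrow> 0) (at (1 :: complex))"
      by (simp add: isCont_def)
    have "((\<lambda>z. g (Arg2pi z) * min 1 (m * cmod (z - 1))) \<longlongrightarrow> 0) (at 1)"
      by (rule Lim_null_comparison[OF _ lim]) (intro always_eventually allI, simp add: abs_mult mult_right_mono assms(2))
    then show ?thesis
      using True by (simp add: isCont_def)
  qed
qed

text \<open>A measurable function is an almost everywhere limit of continuous ones. These are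
  clamped, moved to the circle with the cutoff at 1, and approximated uniformly by polynomials;
  dominated convergence turns pointwise convergence into convergence in \<open>L2\<close>.\<close>

lemma trig_poly_approx_bounded:
  assumes "f \<in> borel_measurable torus" and B: "\<And>x. \<bar>f x\<bar> \<le> B"
  obtains p where "\<And>n. trig_poly (p n)" "(\<lambda>n. \<integral>x. (f x - p n x)\<^sup>2 \<partial>torus) \<longlonglongrightarrow> 0"
proof -
  interpret finite_measure torus by (rule finite_measure_torus)
  \<comment> \<open>The continuous approximants need not be bounded. Clamping to
    \<open>[-B, B]\<close> supplies the dominating constant and leaves \<open>f\<close>
    unchanged.\<close>
  define cl where "cl y = max (- B) (min B y)" for y
  have B0: "0 \<le> B"
    using B[of 0] by linarith
  have cl_bound: "\<bar>cl y\<bar> \<le> B" for y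
    using B0 by (auto simp: cl_def)
  have cl_f: "cl (f x) = f x" for x
    using B[of x] by (auto simp: cl_def)
  have "f measurable_on {0<..<2 * pi}"
    using assms(1) by (simp add: measurable_on_iff_borel_measurable)
  then obtain N g where N: "negligible N" and g: "\<And>n. continuous_on UNIV (g n :: real \<Rightarrow> real)"
    and lim: "\<And>x. x \<notin> N \<Longrightarrow> (\<lambda>n. g n x) \<longlonglongrightarrow> (if x \<in> {0<..<2 * pi} then f x else 0)"
    unfolding measurable_on_def by metis
  \<comment> \<open>The same \<open>n\<close> indexes the approximant, the steepness of the cutoff
    and, below, the polynomial error, so a single diagonal sequence suffices.\<close>
  define H where "H n z = cl (g n (Arg2pi z)) * min 1 (real n * cmod (z - 1))" for n z
  have contH: "continuous_on (sphere 0 1) (H n)" for n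
    unfolding H_def using cl_bound g
    by (intro continuous_on_circle_cutoff) (auto simp: cl_def[abs_def] intro!: continuous_intros)
  have "\<exists>q. real_polynomial_function q \<and> (\<forall>z\<in>sphere 0 1. \<bar>H n z - q z\<bar> < 1 / Suc n)" for n
    by (rule Stone_Weierstrass_real_polynomial_function[OF compact_sphere contH[of n], of "1 / Suc n"]) auto
  then have "\<exists>q. \<forall>n. real_polynomial_function (q n) \<and> (\<forall>z\<in>sphere 0 1. \<bar>H n z - q n z\<bar> < 1 / Suc n)"
    by (intro choice allI)
  then obtain q where q: "\<And>n. real_polynomial_function (q n)"
    and qH: "\<And>n z. z \<in> sphere 0 1 \<Longrightarrow> \<bar>H n z - q n z\<bar> < 1 / Suc n"
    by blast
  define p where "p n x = q n (cis x)" for n x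
  have p: "trig_poly (p n)" for n
    unfolding p_def by (rule trig_poly_real_polynomial_cis[OF q])
  have H_bound: "\<bar>H n z\<bar> \<le> B" for n z
  proof -
    have "\<bar>cl (g n (Arg2pi z))\<bar> * \<bar>min 1 (real n * cmod (z - 1))\<bar> \<le> B * 1"
      by (intro mult_mono cl_bound) (use B0 in auto)
    then show ?thesis
      by (simp add: H_def abs_mult)
  qed
  have p_bound: "\<bar>p n x\<bar> \<le> B + 1" for n x
  proof -
    have "\<bar>H n (cis x) - p n x\<bar> < 1 / Suc n"
      unfolding p_def by (rule qH) simp
    also have "\<dots> \<le> 1"
      by simp
    finally show ?thesis
      using H_bound[of n "cis x"] by linarith
  qed
  have p_lim: "(\<lambda>n. p n x) \<longlonglongrightarrow> f x" if "x \<in> {0<..<2 * pi}" "x \<notin> N" for x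
  proof -
    have arg: "Arg2pi (cis x) = x"
      using that(1) Arg2pi_exp[of "\<i> * of_real x"] by (simp add: cis_conv_exp)
    have "cis x \<noteq> 1"
      using that(1) arg by (metis Arg2pi_of_real greaterThanLessThan_iff less_irrefl not_one_less_zero of_real_1)
    then have pos: "0 < cmod (cis x - 1)"
      by simp
    then obtain n0 where n0: "1 < real n0 * cmod (cis x - 1)"
      using reals_Archimedean3 by blast
    \<comment> \<open>Away from the endpoints \<open>cis x\<close> has positive distance from 1, so
      the cutoff is eventually exactly 1.\<close>
    have "\<forall>\<^sub>F n in sequentially. H n (cis x) = cl (g n x)"
    proof (rule eventually_sequentiallyI[of n0])
      fix n assume "n0 \<le> n"
      then have "real n0 * cmod (cis x - 1) \<le> real n * cmod (cis x - 1)"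
        using pos by (intro mult_right_mono) auto
      with n0 show "H n (cis x) = cl (g n x)"
        by (simp add: H_def arg)
    qed
    moreover have "(\<lambda>n. cl (g n x)) \<longlonglongrightarrow> cl (f x)"
      unfolding cl_def using lim[OF that(2)] that(1) by (intro tendsto_intros) auto
    ultimately have "(\<lambda>n. H n (cis x)) \<longlonglongrightarrow> f x"
      by (simp add: cl_f tendsto_cong)
    moreover have "(\<lambda>n. H n (cis x) - p n x) \<longlonglongrightarrow> 0"
      unfolding p_def
      by (rule Lim_null_comparison[OF _ LIMSEQ_inverse_real_of_nat])
        (use qH[of "cis x"] in \<open>auto simp: less_imp_le inverse_eq_divide\<close>)
    ultimately have "(\<lambda>n. H n (cis x) - (H n (cis x) - p n x)) \<longlonglongrightarrow> f x - 0"
      by (rule tendsto_diff)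
    then show ?thesis
      by simp
  qed
  have "(\<lambda>n. \<integral>x. (f x - p n x)\<^sup>2 \<partial>torus) \<longlonglongrightarrow> (\<integral>x. 0 \<partial>torus)"
  proof (rule integral_dominated_convergence[where w = "\<lambda>_. (2 * B + 1)\<^sup>2"])
    show "(\<lambda>x. (f x - p n x)\<^sup>2) \<in> borel_measurable torus" for n
      using assms(1) trig_poly_L2[OF p[of n]] by (auto simp: in_L2_def)
    have "AE x in lebesgue. x \<notin> N"
      using N by (auto simp: negligible_iff_null_sets AE_not_in)
    then have "AE x in torus. x \<notin> N"
      by (auto simp: AE_restrict_space_iff)
    then show "AE x in torus. (\<lambda>n. (f x - p n x)\<^sup>2) \<longlonglongrightarrow> 0"
    proof (rule AE_mp, intro AE_I2 impI)
      fix x assume "x \<in> space torus" "x \<notin> N"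
      then have "(\<lambda>n. (f x - p n x)\<^sup>2) \<longlonglongrightarrow> (f x - f x)\<^sup>2"
        by (intro tendsto_intros p_lim) auto
      then show "(\<lambda>n. (f x - p n x)\<^sup>2) \<longlonglongrightarrow> 0"
        by simp
    qed
    have "\<bar>f x - p n x\<bar> \<le> 2 * B + 1" for n x
      using B[of x] p_bound[of n x] by linarith
    from power_mono[OF this abs_ge_zero, of _ _ 2]
    show "AE x in torus. norm ((f x - p n x)\<^sup>2) \<le> (2 * B + 1)\<^sup>2" for n
      by simp
  qed auto
  then show ?thesis
    by (intro that[OF p]) simp
qed

text \<open>Truncating the values at level \<open>n\<close> reduces this to the bounded case; the
  truncation error is dominated by \<open>f\<close> itself.\<close>

lemma trig_poly_approx:
  assumes f: "in_L2 f" and "0 < e"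
  obtains T where "trig_poly T" "(\<integral>x. (f x - T x)\<^sup>2 \<partial>torus) < e"
proof -
  define F where "F n x = max (- real n) (min (real n) (f x))" for n x
  have meas: "F n \<in> borel_measurable torus" for n
    using f unfolding F_def[abs_def] in_L2_def by auto
  have bound: "\<bar>F n x\<bar> \<le> real n" for n x
    by (auto simp: F_def)
  have "(\<lambda>n. \<integral>x. (f x - F n x)\<^sup>2 \<partial>torus) \<longlonglongrightarrow> (\<integral>x. 0 \<partial>torus)"
  proof (rule integral_dominated_convergence[where w = "\<lambda>x. (f x)\<^sup>2"])
    show "AE x in torus. (\<lambda>n. (f x - F n x)\<^sup>2) \<longlonglongrightarrow> 0"
    proof (rule AE_I2)
      fix x
      obtain n0 where n0: "\<bar>f x\<bar> \<le> real n0"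
        using real_arch_simple by blast
      have "\<forall>\<^sub>F n in sequentially. (f x - F n x)\<^sup>2 = 0"
        by (rule eventually_sequentiallyI[of n0]) (use n0 in \<open>auto simp: F_def\<close>)
      then show "(\<lambda>n. (f x - F n x)\<^sup>2) \<longlonglongrightarrow> 0"
        by (rule tendsto_eventually)
    qed
    have "\<bar>f x - F n x\<bar> \<le> \<bar>f x\<bar>" for n x
      unfolding F_def by linarith
    from power_mono[OF this abs_ge_zero, of _ _ 2]
    show "AE x in torus. norm ((f x - F n x)\<^sup>2) \<le> (f x)\<^sup>2" for n
      by simp
  qed (use f meas in \<open>auto simp: in_L2_def\<close>)
  then have "(\<lambda>n. \<integral>x. (f x - F n x)\<^sup>2 \<partial>torus) \<longlonglongrightarrow> 0"
    by simp
  \<comment> \<open>Each of the two errors gets \<open>e / 4\<close> because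
    \<open>(a - c)\<^sup>2\<close> costs a factor 2 on either part.\<close>
  from order_tendstoD(2)[OF this, of "e / 4"] \<open>0 < e\<close>
  obtain n where n: "(\<integral>x. (f x - F n x)\<^sup>2 \<partial>torus) < e / 4"
    by (auto simp: eventually_sequentially)
  obtain p where p: "\<And>n. trig_poly (p n)" "(\<lambda>m. \<integral>x. (F n x - p m x)\<^sup>2 \<partial>torus) \<longlonglongrightarrow> 0"
    using trig_poly_approx_bounded[OF meas[of n] bound[of n]] by blast
  from order_tendstoD(2)[OF p(2), of "e / 4"] \<open>0 < e\<close>
  obtain m where m: "(\<integral>x. (F n x - p m x)\<^sup>2 \<partial>torus) < e / 4"
    by (auto simp: eventually_sequentially)
  have Fn: "in_L2 (F n)"
    using meas bound by (intro in_L2_bounded) auto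
  have int: "integrable torus (\<lambda>x. (f x - F n x)\<^sup>2)" "integrable torus (\<lambda>x. (F n x - p m x)\<^sup>2)"
    "integrable torus (\<lambda>x. (f x - p m x)\<^sup>2)"
    using in_L2_diff[OF f Fn] in_L2_diff[OF Fn trig_poly_L2[OF p(1)]] in_L2_diff[OF f trig_poly_L2[OF p(1)]]
    by (auto simp: in_L2_def)
  have sq: "(a - c)\<^sup>2 \<le> 2 * (a - b)\<^sup>2 + 2 * (b - c)\<^sup>2" for a b c :: real
    using zero_le_power2[of "a - b - (b - c)"] by (simp add: power2_eq_square algebra_simps)
  have "(\<integral>x. (f x - p m x)\<^sup>2 \<partial>torus) \<le> (\<integral>x. 2 * (f x - F n x)\<^sup>2 + 2 * (F n x - p m x)\<^sup>2 \<partial>torus)"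
    using int by (intro integral_mono sq) auto
  also have "\<dots> = 2 * (\<integral>x. (f x - F n x)\<^sup>2 \<partial>torus) + 2 * (\<integral>x. (F n x - p m x)\<^sup>2 \<partial>torus)"
    using int by simp
  also have "\<dots> < e"
    using n m by simp
  finally show ?thesis
    using p(1) that by blast
qed

section \<open>Bessel's inequality and completeness\<close>

lemma pairing_commute: "pairing f g = pairing g f"
  by (simp add: pairing_def mult.commute)

lemma pairing_sum_trig:
  assumes "in_L2 f"
  shows "pairing f (\<lambda>x. \<Sum>k\<in>S. c k * trig k x) = (\<Sum>k\<in>S. c k * pairing f (trig k))"
proof -
  have "pairing f (\<lambda>x. \<Sum>k\<in>S. c k * trig k x) = (\<integral>x. (\<Sum>k\<in>S. c k * (f x * trig k x)) \<partial>torus)"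
    unfolding pairing_def by (simp add: sum_distrib_left mult_ac)
  also have "\<dots> = (\<Sum>k\<in>S. c k * pairing f (trig k))"
    unfolding pairing_def using integrable_mult_L2[OF assms in_L2_trig]
    by (subst Bochner_Integration.integral_sum) auto
  finally show ?thesis .
qed

text \<open>The coefficients are left free: the Fourier coefficients yield Bessel's inequality,
  arbitrary ones its approximate converse.\<close>

lemma integral_diff_trig_sq:
  assumes f: "in_L2 f" and "finite S"
  shows "(\<integral>x. (f x - (\<Sum>k\<in>S. c k * trig k x))\<^sup>2 \<partial>torus) =
    (\<integral>x. (f x)\<^sup>2 \<partial>torus) - 2 * (\<Sum>k\<in>S. c k * pairing f (trig k)) + (\<Sum>k\<in>S. (c k)\<^sup>2 * trig_norm_sq k)"
proof -
  define T where "T = (\<lambda>x. \<Sum>k\<in>S. c k * trig k x)"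
  have T: "in_L2 T"
    unfolding T_def by (rule in_L2_sum_trig)
  have int: "integrable torus (\<lambda>x. (f x)\<^sup>2)" "integrable torus (\<lambda>x. f x * T x)" "integrable torus (\<lambda>x. T x * T x)"
    using f T integrable_mult_L2 by (auto simp: in_L2_def)
  have "(\<integral>x. (f x - T x)\<^sup>2 \<partial>torus) = (\<integral>x. (f x)\<^sup>2 - 2 * (f x * T x) + T x * T x \<partial>torus)"
    by (intro Bochner_Integration.integral_cong refl) (simp add: power2_eq_square algebra_simps)
  also have "\<dots> = (\<integral>x. (f x)\<^sup>2 \<partial>torus) - 2 * pairing f T + pairing T T"
    using int by (simp add: pairing_def)
  also have "pairing f T = (\<Sum>k\<in>S. c k * pairing f (trig k))"
    unfolding T_def by (rule pairing_sum_trig[OF f])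
  also have "pairing T T = (\<Sum>k\<in>S. c k * pairing T (trig k))"
    by (subst (2) T_def) (rule pairing_sum_trig[OF T])
  also have "\<dots> = (\<Sum>k\<in>S. (c k)\<^sup>2 * trig_norm_sq k)"
  proof (rule sum.cong[OF refl])
    fix k assume k: "k \<in> S"
    have "pairing T (trig k) = (\<Sum>j\<in>S. c j * pairing (trig k) (trig j))"
      unfolding pairing_commute[of T] by (subst T_def) (rule pairing_sum_trig[OF in_L2_trig])
    also have "\<dots> = c k * trig_norm_sq k"
      using k \<open>finite S\<close> by (simp add: pairing_trig_trig if_distrib[of "(*) _"] cong: if_cong)
    finally show "c k * pairing T (trig k) = (c k)\<^sup>2 * trig_norm_sq k"
      by (simp add: power2_eq_square)
  qed
  finally show ?thesis
    by (simp add: T_def)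
qed

lemma trig_norm_sq_pos: "0 < trig_norm_sq k"
  by (simp add: trig_norm_sq_def)

text \<open>With \<open>c k\<close> the Fourier coefficient, the two sums in the expansion of the
  nonnegative squared distance coincide up to the factor \<open>- 2\<close>.\<close>

lemma Bessel_trig:
  assumes "in_L2 f" "finite S"
  shows "(\<Sum>k\<in>S. (pairing f (trig k))\<^sup>2 / trig_norm_sq k) \<le> (\<integral>x. (f x)\<^sup>2 \<partial>torus)"
proof -
  let ?p = "\<lambda>k. pairing f (trig k)"
  have "0 \<le> (\<integral>x. (f x - (\<Sum>k\<in>S. ?p k / trig_norm_sq k * trig k x))\<^sup>2 \<partial>torus)"
    by (rule integral_nonneg_AE) simp
  also have "\<dots> = (\<integral>x. (f x)\<^sup>2 \<partial>torus) - 2 * (\<Sum>k\<in>S. ?p k / trig_norm_sq k * ?p k)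
      + (\<Sum>k\<in>S. (?p k / trig_norm_sq k)\<^sup>2 * trig_norm_sq k)"
    by (rule integral_diff_trig_sq[OF assms])
  also have "(\<Sum>k\<in>S. ?p k / trig_norm_sq k * ?p k) = (\<Sum>k\<in>S. (?p k)\<^sup>2 / trig_norm_sq k)"
    by (simp add: power2_eq_square)
  also have "(\<Sum>k\<in>S. (?p k / trig_norm_sq k)\<^sup>2 * trig_norm_sq k) = (\<Sum>k\<in>S. (?p k)\<^sup>2 / trig_norm_sq k)"
    using trig_norm_sq_pos by (intro sum.cong refl) (simp add: power2_eq_square less_imp_neq[symmetric])
  finally show ?thesis
    by simp
qed

text \<open>Completing the square mode by mode: no choice of \<open>c\<close> on \<open>S\<close>
  comes closer to \<open>f\<close> than the Fourier coefficients. Hence any good approximation shows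
  that the Bessel sum is nearly the full integral.\<close>

lemma integral_sq_le_Bessel_plus_dist:
  assumes "in_L2 f" "finite S"
  shows "(\<integral>x. (f x)\<^sup>2 \<partial>torus) \<le> (\<Sum>k\<in>S. (pairing f (trig k))\<^sup>2 / trig_norm_sq k)
    + (\<integral>x. (f x - (\<Sum>k\<in>S. c k * trig k x))\<^sup>2 \<partial>torus)"
proof -
  let ?p = "\<lambda>k. pairing f (trig k)"
  have "2 * (c k * ?p k) - (c k)\<^sup>2 * trig_norm_sq k \<le> (?p k)\<^sup>2 / trig_norm_sq k" for k
  proof -
    have "0 \<le> (?p k - c k * trig_norm_sq k)\<^sup>2 / trig_norm_sq k"
      using trig_norm_sq_pos[of k] by simp
    also have "\<dots> = (?p k)\<^sup>2 / trig_norm_sq k - 2 * (c k * ?p k) + (c k)\<^sup>2 * trig_norm_sq k"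
      using trig_norm_sq_pos[of k] by (simp add: field_simps power2_eq_square)
    finally show ?thesis
      by linarith
  qed
  then have "(\<Sum>k\<in>S. 2 * (c k * ?p k) - (c k)\<^sup>2 * trig_norm_sq k) \<le> (\<Sum>k\<in>S. (?p k)\<^sup>2 / trig_norm_sq k)"
    by (rule sum_mono)
  then show ?thesis
    unfolding integral_diff_trig_sq[OF assms] by (simp add: sum_subtractf sum_distrib_left)
qed

text \<open>Bessel bounds the partial sums above by the integral; an approximating trigonometric
  polynomial bounds them below up to \<open>e\<close> once the interval contains its
  frequencies.\<close>

lemma Parseval_trig:
  assumes f: "in_L2 f"
  shows "(\<lambda>n. \<Sum>k\<in>{- int n..int n}. (pairing f (trig k))\<^sup>2 / trig_norm_sq k) \<longlonglongrightarrow> (\<integral>x. (f x)\<^sup>2 \<partial>torus)"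
    (is "?s \<longlonglongrightarrow> ?I")
proof (rule LIMSEQ_I)
  fix e :: real assume "0 < e"
  then obtain T where T: "trig_poly T" "(\<integral>x. (f x - T x)\<^sup>2 \<partial>torus) < e"
    by (rule trig_poly_approx[OF f])
  then obtain S c where S: "finite S" "(\<integral>x. (f x - (\<Sum>k\<in>S. c k * trig k x))\<^sup>2 \<partial>torus) < e"
    by (auto simp: trig_poly_def)
  obtain n0 where n0: "S \<subseteq> {- int n0..int n0}"
  proof -
    \<comment> \<open>The inserted 0 keeps \<open>Max\<close> meaningful for empty
      \<open>S\<close>.\<close>
    have "S \<subseteq> {- int (Max (insert 0 (nat ` abs ` S)))..int (Max (insert 0 (nat ` abs ` S)))}"
    proof
      fix k assume "k \<in> S"
      then have "nat \<bar>k\<bar> \<le> Max (insert 0 (nat ` abs ` S))"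
        using S(1) by (intro Max_ge) auto
      then show "k \<in> {- int (Max (insert 0 (nat ` abs ` S)))..int (Max (insert 0 (nat ` abs ` S)))}"
        by (simp add: nat_le_iff abs_le_iff)
    qed
    then show ?thesis
      using that by blast
  qed
  show "\<exists>no. \<forall>n\<ge>no. norm (?s n - ?I) < e"
  proof (intro exI[of _ n0] allI impI)
    fix n assume "n0 \<le> n"
    have "(\<Sum>k\<in>S. (pairing f (trig k))\<^sup>2 / trig_norm_sq k) \<le> ?s n"
      using n0 \<open>n0 \<le> n\<close> trig_norm_sq_pos by (intro sum_mono2) (auto simp: less_imp_le)
    moreover have "?s n \<le> ?I"
      by (rule Bessel_trig[OF f]) simp
    ultimately show "norm (?s n - ?I) < e"
      using integral_sq_le_Bessel_plus_dist[OF f S(1), of c] S(2) by simp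
  qed
qed

text \<open>The unnormalized integral of \<open>f\<close> against \<open>exp (i k x)\<close>, with a
  plus sign in the exponent. Since \<open>f\<close> is real, natural \<open>k\<close> carry all the
  information.\<close>

definition fourier_coeff :: "(real \<Rightarrow> real) \<Rightarrow> nat \<Rightarrow> complex" where
  "fourier_coeff f k = Complex (pairing f (\<lambda>x. cos (real k * x))) (pairing f (\<lambda>x. sin (real k * x)))"

lemma sum_symmetric_interval:
  "(\<Sum>k\<in>{- int n..int n}. g k) = g 0 + (\<Sum>k=1..n. g (int k) + g (- int k))" for g :: "int \<Rightarrow> real"
proof (induction n)
  case (Suc n)
  have "{- int (Suc n)..int (Suc n)} = insert (int (Suc n)) (insert (- int (Suc n)) {- int n..int n})"
    by auto
  then have "(\<Sum>k\<in>{- int (Suc n)..int (Suc n)}. g k) = g (int (Suc n)) + (g (- int (Suc n)) + (\<Sum>k\<in>{- int n..int n}. g k))"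
    by simp
  then show ?case
    using Suc by simp
qed simp

text \<open>The indices \<open>k\<close> and \<open>- k\<close> merge into one complex coefficient;
  the sign of the sine disappears in the square.\<close>

lemma Parseval:
  assumes f: "in_L2 f"
  shows "(\<lambda>n. (cmod (fourier_coeff f 0))\<^sup>2 / (2 * pi) + (\<Sum>k=1..n. (cmod (fourier_coeff f k))\<^sup>2 / pi))
    \<longlonglongrightarrow> (\<integral>x. (f x)\<^sup>2 \<partial>torus)"
proof -
  have "(pairing f (trig (int k)))\<^sup>2 / trig_norm_sq (int k) + (pairing f (trig (- int k)))\<^sup>2 / trig_norm_sq (- int k)
      = (cmod (fourier_coeff f k))\<^sup>2 / pi" if "k \<ge> 1" for k
  proof -
    have "trig (int k) = (\<lambda>x. cos (real k * x))"
      by (auto simp: trig_def)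
    moreover have "pairing f (trig (- int k)) = - pairing f (\<lambda>x. sin (real k * x))"
      using that by (simp add: pairing_def trig_def)
    ultimately show ?thesis
      using that by (simp add: trig_norm_sq_def fourier_coeff_def cmod_power2 add_divide_distrib)
  qed
  moreover have "(pairing f (trig 0))\<^sup>2 / trig_norm_sq 0 = (cmod (fourier_coeff f 0))\<^sup>2 / (2 * pi)"
    by (simp add: trig_norm_sq_def trig_def[abs_def] fourier_coeff_def cmod_power2) (simp add: pairing_def)
  ultimately show ?thesis
    using Parseval_trig[OF f] by (simp add: sum_symmetric_interval)
qed

section \<open>The Fourier modes of a solution\<close>

text \<open>The span of cosine and sine at one frequency is closed under \<open>deriv\<close>, so
  smoothness follows by induction over the whole span rather than for one function.\<close>

lemma test_function_trig: "test_function (\<lambda>x. A * cos (real k * x) + B * sin (real k * x))"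
proof -
  let ?f = "\<lambda>A B x. A * cos (real k * x) + B * sin (real k * x)"
  have d: "(?f A B has_real_derivative ?f (real k * B) (- real k * A) x) (at x)" for A B x
    by (auto intro!: derivative_eq_intros simp: algebra_simps)
  have "\<exists>A' B'. (deriv ^^ n) (?f A B) = ?f A' B'" for n
  proof (induction n)
    case 0
    show ?case
      by (intro exI[of _ A] exI[of _ B]) simp
  next
    case (Suc n)
    then obtain A' B' where "(deriv ^^ n) (?f A B) = ?f A' B'"
      by blast
    moreover have "deriv (?f A' B') = ?f (real k * B') (- real k * A')"
      using DERIV_imp_deriv[OF d] by blast
    ultimately have "(deriv ^^ Suc n) (?f A B) = ?f (real k * B') (- real k * A')"
      by simp
    then show ?case
      by blast
  qed
  then have "(deriv ^^ n) (?f A B) differentiable at x" for n x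
  proof -
    obtain A' B' where "(deriv ^^ n) (?f A B) = ?f A' B'"
      using \<open>\<And>n. \<exists>A' B'. (deriv ^^ n) (?f A B) = ?f A' B'\<close> by blast
    then show ?thesis
      using d[of A' B' x] by (auto simp only: real_differentiable_def)
  qed
  moreover have "?f A B (x + 2 * pi) = ?f A B x" for x
    using sin_cos_eq_iff[of "real k * (x + 2 * pi)" "real k * x"] cos_add[of "real k * x" "2 * pi * real k"]
      sin_add[of "real k * x" "2 * pi * real k"] cos_2npi[of k] sin_2npi[of k]
    by (simp add: algebra_simps)
  ultimately show ?thesis
    by (simp add: test_function_def)
qed

lemma test_function_cos: "test_function (\<lambda>x. cos (real k * x))"
  and test_function_sin: "test_function (\<lambda>x. sin (real k * x))"
  using test_function_trig[of 1 k 0] test_function_trig[of 0 k 1] by simp_all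

text \<open>The Fourier multiplier of \<open>- \<alpha> \<partial>\<^sub>x + \<beta>
  \<partial>\<^sub>x\<^sup>2\<close>. The imaginary part is positive in \<open>\<alpha>\<close>
  because coefficients are taken against \<open>exp (i k x)\<close>.\<close>

definition symbol :: "real \<Rightarrow> real \<Rightarrow> nat \<Rightarrow> complex" where
  "symbol \<alpha> \<beta> k = Complex (- \<beta> * (real k)\<^sup>2) (\<alpha> * real k)"

lemma conv_diff_fourier:
  "Complex (conv_diff \<alpha> \<beta> f (\<lambda>x. cos (real k * x))) (conv_diff \<alpha> \<beta> f (\<lambda>x. sin (real k * x)))
    = symbol \<alpha> \<beta> k * fourier_coeff f k"
proof -
  have c: "deriv (\<lambda>x. cos (real k * x)) = (\<lambda>x. (- real k) * sin (real k * x))"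
    by (rule ext, rule DERIV_imp_deriv) (auto intro!: derivative_eq_intros)
  have s: "deriv (\<lambda>x. sin (real k * x)) = (\<lambda>x. real k * cos (real k * x))"
    by (rule ext, rule DERIV_imp_deriv) (auto intro!: derivative_eq_intros)
  have cc: "deriv (\<lambda>x. - real k * sin (real k * x)) = (\<lambda>x. (- (real k)\<^sup>2) * cos (real k * x))"
    by (rule ext, rule DERIV_imp_deriv) (auto intro!: derivative_eq_intros simp: power2_eq_square)
  have ss: "deriv (\<lambda>x. real k * cos (real k * x)) = (\<lambda>x. (- (real k)\<^sup>2) * sin (real k * x))"
    by (rule ext, rule DERIV_imp_deriv) (auto intro!: derivative_eq_intros simp: power2_eq_square)
  have p: "pairing f (\<lambda>x. c * g x) = c * pairing f g" for c g
    unfolding pairing_def by (simp add: mult.left_commute[of _ c])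
  show ?thesis
    by (simp only: conv_diff_def c s cc ss p symbol_def fourier_coeff_def complex_eq_iff
        complex.sel times_complex.simps) (simp add: algebra_simps)
qed

lemma evolves_by_fourier:
  assumes "evolves_by f R"
  shows "continuous_on {0..} (\<lambda>t. fourier_coeff (f t) k)"
    and "t > 0 \<Longrightarrow> ((\<lambda>t. fourier_coeff (f t) k) has_vector_derivative
      Complex (R t (\<lambda>x. cos (real k * x))) (R t (\<lambda>x. sin (real k * x)))) (at t)"
proof -
  note c = assms[unfolded evolves_by_def, rule_format, OF test_function_cos[of k]]
    and s = assms[unfolded evolves_by_def, rule_format, OF test_function_sin[of k]]
  show "continuous_on {0..} (\<lambda>t. fourier_coeff (f t) k)"
    unfolding fourier_coeff_def Complex_eq using c s by (intro continuous_intros) auto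
  have *: "((\<lambda>t. complex_of_real (p t)) has_vector_derivative of_real p') (at t)"
    if "(p has_real_derivative p') (at t)" for p p' t
    using bounded_linear.has_vector_derivative[OF bounded_linear_of_real] that
    by (simp add: has_real_derivative_iff_has_vector_derivative)
  show "((\<lambda>t. fourier_coeff (f t) k) has_vector_derivative
      Complex (R t (\<lambda>x. cos (real k * x))) (R t (\<lambda>x. sin (real k * x)))) (at t)" if "t > 0"
    unfolding fourier_coeff_def Complex_eq using c s that
    by (intro has_vector_derivative_add has_vector_derivative_mult_right *) auto
qed

text \<open>Variation of constants for resonant forcing: the forcing carries the factor
  \<open>exp (t *\<^sub>R lam)\<close>, so the integrating factor leaves just \<open>g\<close>, and
  any antiderivative \<open>G\<close> with \<open>G 0 = 0\<close> replaces the integral.\<close>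

lemma Duhamel:
  fixes F G g :: "real \<Rightarrow> complex"
  assumes F: "continuous_on {0..} F"
    and F': "\<And>t. t > 0 \<Longrightarrow> (F has_vector_derivative lam * F t + exp (t *\<^sub>R lam) * g t) (at t)"
    and G': "\<And>t. (G has_vector_derivative g t) (at t)" and "G 0 = 0" and "0 \<le> t"
  shows "F t = exp (t *\<^sub>R lam) * (F 0 + G t)"
proof -
  have e: "((\<lambda>t. exp (t *\<^sub>R (- lam))) has_vector_derivative exp (t *\<^sub>R (- lam)) * (- lam)) (at t)" for t
    by (rule exp_scaleR_has_vector_derivative_right)
  have inv: "exp (t *\<^sub>R (- lam)) * exp (t *\<^sub>R lam) = 1" for t
    by (simp add: exp_add[symmetric])
  have "exp (t *\<^sub>R (- lam)) * F t - G t = F 0"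
  \<comment> \<open>The equation is known only for positive times; 0 is the exceptional point, where
    continuity is enough.\<close>
  proof (rule has_derivative_zero_unique_strong_interval[where k = "{0}" and a = 0 and b = t
        and f = "\<lambda>t. exp (t *\<^sub>R (- lam)) * F t - G t"])
    have "continuous_on {0..t} G"
      using G' has_vector_derivative_continuous by (blast intro: continuous_at_imp_continuous_on)
    then show "continuous_on {0..t} (\<lambda>t. exp (t *\<^sub>R (- lam)) * F t - G t)"
      by (intro continuous_intros continuous_on_subset[OF F]) auto
    fix s assume "s \<in> {0..t} - {0}"
    then have "s > 0"
      by auto
    have "((\<lambda>t. exp (t *\<^sub>R (- lam)) * F t - G t) has_vector_derivative
        exp (s *\<^sub>R (- lam)) * (lam * F s + exp (s *\<^sub>R lam) * g s) + exp (s *\<^sub>R (- lam)) * (- lam) * F s - g s) (at s)"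
      by (intro has_vector_derivative_diff has_vector_derivative_mult e F' G' \<open>s > 0\<close>)
    also have "exp (s *\<^sub>R (- lam)) * (lam * F s + exp (s *\<^sub>R lam) * g s) + exp (s *\<^sub>R (- lam)) * (- lam) * F s - g s
        = (exp (s *\<^sub>R (- lam)) * exp (s *\<^sub>R lam) - 1) * g s"
      by (simp add: algebra_simps)
    finally show "((\<lambda>t. exp (t *\<^sub>R (- lam)) * F t - G t) has_derivative (\<lambda>h. 0)) (at s within {0..t})"
      by (simp only: inv has_vector_derivative_def) (auto intro: has_derivative_at_withinI)
  qed (use assms in auto)
  then have "exp (t *\<^sub>R (- lam)) * F t = F 0 + G t"
    by (simp only: diff_eq_eq)
  then have "exp (t *\<^sub>R lam) * (F 0 + G t) = (exp (t *\<^sub>R (- lam)) * exp (t *\<^sub>R lam)) * F t"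
    by (metis mult.assoc mult.commute)
  then show ?thesis
    by (simp only: inv mult_1)
qed

text \<open>All three equations share \<open>lam\<close>, so each forcing is resonant and
  contributes secular terms. The result is what differentiating
  \<open>exp (t *\<^sub>R lam) * U 0\<close> once and twice in \<open>z\<close> would give, with
  \<open>l1\<close>, \<open>l2\<close> as derivatives of \<open>lam\<close> and \<open>V 0\<close>,
  \<open>W 0\<close> as those of \<open>U 0\<close>.\<close>

lemma triangular_system_solution:
  fixes U V W :: "real \<Rightarrow> complex"
  assumes cont: "continuous_on {0..} U" "continuous_on {0..} V" "continuous_on {0..} W"
    and U': "\<And>t. t > 0 \<Longrightarrow> (U has_vector_derivative lam * U t) (at t)"
    and V': "\<And>t. t > 0 \<Longrightarrow> (V has_vector_derivative l1 * U t + lam * V t) (at t)"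
    and W': "\<And>t. t > 0 \<Longrightarrow> (W has_vector_derivative l2 * U t + 2 * l1 * V t + lam * W t) (at t)"
    and "0 \<le> t"
  shows "U t = exp (t *\<^sub>R lam) * U 0"
    and "V t = exp (t *\<^sub>R lam) * (V 0 + t *\<^sub>R l1 * U 0)"
    and "W t = exp (t *\<^sub>R lam) *
      (W 0 + (2 * (t *\<^sub>R l1 * V 0) + (t *\<^sub>R l2 + (t *\<^sub>R l1)\<^sup>2) * U 0))"
proof -
  have lin: "((\<lambda>t. t *\<^sub>R c) has_vector_derivative c) (at t)" for c :: complex and t
    by (auto intro!: derivative_eq_intros)
  have U: "U t = exp (t *\<^sub>R lam) * U 0" if "0 \<le> t" for t
    using Duhamel[of U lam "\<lambda>_. 0" "\<lambda>_. 0", OF cont(1) _ _ _ that] U' by simp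
  have V: "V t = exp (t *\<^sub>R lam) * (V 0 + t *\<^sub>R (l1 * U 0))" if "0 \<le> t" for t
  proof (rule Duhamel[OF cont(2) _ lin _ that])
    fix t :: real assume "t > 0"
    then show "(V has_vector_derivative lam * V t + exp (t *\<^sub>R lam) * (l1 * U 0)) (at t)"
      using V'[of t] U[of t] by (simp add: algebra_simps)
  qed simp
  \<comment> \<open>The forcing of \<open>W\<close> contains \<open>V\<close> and is therefore
    affine in \<open>t\<close> after removing the exponential; this is its antiderivative.\<close>
  have quad: "((\<lambda>t. t *\<^sub>R A + (t\<^sup>2) *\<^sub>R B) has_vector_derivative A + (2 * t) *\<^sub>R B) (at t)" for A B :: complex and t
    by (auto intro!: derivative_eq_intros)
  have W: "W t = exp (t *\<^sub>R lam) *
      (W 0 + (t *\<^sub>R (l2 * U 0 + 2 * l1 * V 0) + (t\<^sup>2) *\<^sub>R (l1\<^sup>2 * U 0)))" if "0 \<le> t" for t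
  proof (rule Duhamel[OF cont(3) _ quad _ that])
    fix t :: real assume "t > 0"
    then show "(W has_vector_derivative lam * W t +
        exp (t *\<^sub>R lam) * (l2 * U 0 + 2 * l1 * V 0 + (2 * t) *\<^sub>R (l1\<^sup>2 * U 0))) (at t)"
      using W'[of t] U[of t] V[of t]
      by (simp add: algebra_simps power2_eq_square scaleR_conv_of_real)
  qed simp
  show "U t = exp (t *\<^sub>R lam) * U 0"
    by (rule U[OF \<open>0 \<le> t\<close>])
  show "V t = exp (t *\<^sub>R lam) * (V 0 + t *\<^sub>R l1 * U 0)"
    using V[OF \<open>0 \<le> t\<close>] by simp
  \<comment> \<open>Regrouped so that \<open>l1\<close> and \<open>l2\<close> occur only multiplied
    by \<open>t\<close>, the combination that is estimated later.\<close>
  have "t *\<^sub>R (l2 * U 0 + 2 * l1 * V 0) + (t\<^sup>2) *\<^sub>R (l1\<^sup>2 * U 0)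
      = 2 * (t *\<^sub>R l1 * V 0) + (t *\<^sub>R l2 + (t *\<^sub>R l1)\<^sup>2) * U 0"
    by (simp add: scaleR_conv_of_real power2_eq_square ring_distribs)
  then show "W t = exp (t *\<^sub>R lam) *
      (W 0 + (2 * (t *\<^sub>R l1 * V 0) + (t *\<^sub>R l2 + (t *\<^sub>R l1)\<^sup>2) * U 0))"
    using W[OF \<open>0 \<le> t\<close>] by simp
qed

text \<open>
  The factors \<open>k\<^sup>2\<close> from the symbols would be unbounded in \<open>k\<close>; they are absorbed by the surplus
  decay \<open>exp (- c s)\<close> with \<open>s = (k\<^sup>2 - 1) t\<close>, since \<open>k\<^sup>2 t = t + s\<close>.
\<close>

lemma surplus_decay:
  assumes "0 < c" "0 \<le> t" "0 \<le> (s :: real)"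
  shows "(t + s) * exp (- c * s) \<le> t + 2 / c"
    and "(t + s)\<^sup>2 * exp (- c * s) \<le> (t + 2 / c)\<^sup>2"
proof -
  \<comment> \<open>Half of the available decay: one factor \<open>h\<close> pays for one power of
    \<open>s\<close>, and two of them pay for the square.\<close>
  define h where "h = exp (- (c * s / 2))"
  have h: "0 < h" "h \<le> 1"
    using assms by (auto simp: h_def)
  have hh: "exp (- c * s) = h * h"
    by (simp add: h_def exp_add[symmetric])
  have "c * s / 2 \<le> exp (c * s / 2)"
    using exp_ge_add_one_self[of "c * s / 2"] by linarith
  then have "c * s / 2 * h \<le> exp (c * s / 2) * h"
    using h by (intro mult_right_mono) auto
  also have "\<dots> = 1"
    by (simp add: h_def exp_add[symmetric])
  finally have "s * h \<le> 2 / c"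
    using assms by (simp add: field_simps)
  moreover have "t * h \<le> t"
    using h assms by (simp add: mult_left_le)
  ultimately have le: "(t + s) * h \<le> t + 2 / c"
    by (simp add: distrib_right)
  have "(t + s) * exp (- c * s) = ((t + s) * h) * h"
    by (simp only: hh mult.assoc)
  also have "\<dots> \<le> (t + s) * h"
    using h assms by (intro mult_left_le) auto
  finally show "(t + s) * exp (- c * s) \<le> t + 2 / c"
    using le by linarith
  have "(t + s)\<^sup>2 * exp (- c * s) = ((t + s) * h)\<^sup>2"
    by (simp only: hh power_mult_distrib power2_eq_square[of h])
  also have "\<dots> \<le> (t + 2 / c)\<^sup>2"
    using le h assms by (intro power_mono) auto
  finally show "(t + s)\<^sup>2 * exp (- c * s) \<le> (t + 2 / c)\<^sup>2" .
qed

text \<open>For natural \<open>k\<close> the transport factor \<open>k\<close> is at most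
  \<open>k\<^sup>2\<close>, so both terms fit under the diffusive growth. The bound serves the
  \<open>z\<close>-derivatives of the symbol; of the symbol itself only the real part is
  estimated.\<close>

lemma norm_symbol_le:
  assumes "\<bar>\<alpha>\<bar> \<le> M" "\<bar>\<beta>\<bar> \<le> M"
  shows "cmod (symbol \<alpha> \<beta> k) \<le> 2 * M * (real k)\<^sup>2"
proof -
  have k: "real k \<le> (real k)\<^sup>2"
    by (cases k) (auto simp: power2_eq_square)
  have "cmod (symbol \<alpha> \<beta> k) \<le> \<bar>\<beta>\<bar> * (real k)\<^sup>2 + \<bar>\<alpha>\<bar> * real k"
    using cmod_le[of "symbol \<alpha> \<beta> k"] by (simp add: symbol_def abs_mult)
  also have "\<dots> \<le> M * (real k)\<^sup>2 + M * (real k)\<^sup>2"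
    using assms k by (intro add_mono mult_mono) auto
  finally show ?thesis
    by simp
qed

lemma mode_bound:
  fixes U0 V0 W0 lam l1 l2 :: complex and k :: nat
  assumes "k \<ge> 1" "0 < c" "0 \<le> t" "0 \<le> M"
    and lam: "Re lam \<le> - c * (real k)\<^sup>2"
    and l1: "cmod l1 \<le> 2 * M * (real k)\<^sup>2" and l2: "cmod l2 \<le> 2 * M * (real k)\<^sup>2"
  defines "X \<equiv> cmod U0 + cmod V0 + cmod W0"
    and "P \<equiv> exp (- c * t) * (1 + 2 * M * (t + 2 / c))\<^sup>2"
  shows "cmod (exp (t *\<^sub>R lam) * U0) \<le> P * X"
    and "cmod (exp (t *\<^sub>R lam) * (V0 + t *\<^sub>R l1 * U0)) \<le> P * X"
    and "cmod (exp (t *\<^sub>R lam) * (W0 + (2 * (t *\<^sub>R l1 * V0) + (t *\<^sub>R l2 + (t *\<^sub>R l1)\<^sup>2) * U0))) \<le> P * X"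
proof -
  define s where "s = ((real k)\<^sup>2 - 1) * t"
  define E e L where "E = exp (- c * t)" and "e = exp (- c * s)" and "L = t + 2 / c"
  have "1 \<le> (real k)\<^sup>2"
    using \<open>k \<ge> 1\<close> by (simp add: one_le_power)
  then have s: "0 \<le> s" "t + s = t * (real k)\<^sup>2"
    using \<open>0 \<le> t\<close> mult_left_mono[of 1 "(real k)\<^sup>2" t] by (auto simp: s_def algebra_simps)
  have "0 < E" "0 < e" "e \<le> 1" "0 \<le> L"
    using assms s by (auto simp: E_def e_def L_def)
  have decay: "(t + s) * e \<le> L" "(t + s)\<^sup>2 * e \<le> L\<^sup>2"
    using surplus_decay[OF \<open>0 < c\<close> \<open>0 \<le> t\<close> s(1)] by (auto simp: e_def L_def)
  have "t * Re lam \<le> t * (- c * (real k)\<^sup>2)"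
    using lam \<open>0 \<le> t\<close> by (rule mult_left_mono)
  also have "\<dots> = - c * t + - c * s"
    by (simp add: s_def algebra_simps)
  finally have exp_le: "cmod (exp (t *\<^sub>R lam)) \<le> E * e"
    by (simp add: E_def e_def exp_add[symmetric])
  have tl: "cmod (t *\<^sub>R l) \<le> 2 * M * (t + s)" if "cmod l \<le> 2 * M * (real k)\<^sup>2" for l
    using mult_left_mono[OF that \<open>0 \<le> t\<close>] \<open>0 \<le> t\<close> by (simp add: s(2) mult_ac)
  have tl1: "cmod (t *\<^sub>R l1) \<le> 2 * M * (t + s)" and tl2: "cmod (t *\<^sub>R l2) \<le> 2 * M * (t + s)"
    using tl l1 l2 by auto
  \<comment> \<open>The hypothesis is the expanded form of
    \<open>(1 + 2 * M * (t + s))\<^sup>2 * X\<close>. Each power of \<open>t + s\<close> is absorbed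
    by \<open>e\<close> separately, and the resulting bounds recombine to the square in
    \<open>P\<close>.\<close>
  have main: "cmod (exp (t *\<^sub>R lam) * Z) \<le> P * X"
    if "cmod Z \<le> (1 + 4 * M * (t + s) + (2 * M)\<^sup>2 * (t + s)\<^sup>2) * X" for Z
  proof -
    have X: "0 \<le> X"
      by (simp add: X_def)
    have "cmod (exp (t *\<^sub>R lam) * Z) \<le> (E * e) * ((1 + 4 * M * (t + s) + (2 * M)\<^sup>2 * (t + s)\<^sup>2) * X)"
      unfolding norm_mult using exp_le that \<open>0 < E\<close> \<open>0 < e\<close> by (intro mult_mono) auto
    also have "\<dots> = E * X * (e + 4 * M * ((t + s) * e) + (2 * M)\<^sup>2 * ((t + s)\<^sup>2 * e))"
      by (simp add: algebra_simps)
    also have "\<dots> \<le> E * X * (1 + 4 * M * L + (2 * M)\<^sup>2 * L\<^sup>2)"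
      using decay \<open>e \<le> 1\<close> \<open>0 < E\<close> X \<open>0 \<le> M\<close> by (intro mult_left_mono add_mono) auto
    also have "\<dots> = P * X"
      unfolding P_def E_def L_def[symmetric] by (simp add: power2_eq_square algebra_simps)
    finally show ?thesis .
  qed
  define r where "r = t + s"
  have r: "0 \<le> r" "0 \<le> M * r"
    using s(1) assms by (auto simp: r_def)
  let ?u = "cmod U0" and ?v = "cmod V0" and ?w = "cmod W0"
  note tl1 = tl1[folded r_def] and tl2 = tl2[folded r_def] and main = main[folded r_def]
  have "0 \<le> 2 * M * r * ?v" "0 \<le> 2 * M * r * ?w" "0 \<le> 2 * M * r * ?u"
    using r(1) \<open>0 \<le> M\<close> by auto
  moreover have "0 \<le> (2 * M)\<^sup>2 * r\<^sup>2 * ?v" "0 \<le> (2 * M)\<^sup>2 * r\<^sup>2 * ?w" "0 \<le> (2 * M)\<^sup>2 * r\<^sup>2 * ?u"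
    by auto
  \<comment> \<open>Fully expanded, the products act as atoms, and \<open>linarith\<close> can
    compare the three estimates with it.\<close>
  moreover have expand: "(1 + 4 * M * r + (2 * M)\<^sup>2 * r\<^sup>2) * X =
     ?u + ?v + ?w + 2 * (2 * M * r * ?u) + 2 * (2 * M * r * ?v) + 2 * (2 * M * r * ?w)
     + (2 * M)\<^sup>2 * r\<^sup>2 * ?u + (2 * M)\<^sup>2 * r\<^sup>2 * ?v + (2 * M)\<^sup>2 * r\<^sup>2 * ?w"
    by (simp add: X_def algebra_simps)
  moreover note norm_ge_zero[of U0] norm_ge_zero[of V0] norm_ge_zero[of W0]
  moreover have l1u: "cmod (t *\<^sub>R l1 * U0) \<le> 2 * M * r * ?u" and l1v: "cmod (t *\<^sub>R l1 * V0) \<le> 2 * M * r * ?v"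
    unfolding norm_mult[of _ U0] norm_mult[of _ V0] by (intro mult_right_mono tl1; simp)+
  moreover have "cmod ((t *\<^sub>R l2 + (t *\<^sub>R l1)\<^sup>2) * U0) \<le> 2 * M * r * ?u + (2 * M)\<^sup>2 * r\<^sup>2 * ?u"
  proof -
    have "cmod (t *\<^sub>R l2 + (t *\<^sub>R l1)\<^sup>2) \<le> 2 * M * r + (2 * M * r)\<^sup>2"
      using power_mono[OF tl1 norm_ge_zero, of 2] tl2
      by (intro norm_triangle_le add_mono) (auto simp: norm_power power_mult_distrib)
    from mult_right_mono[OF this norm_ge_zero[of U0]] show ?thesis
      by (simp only: norm_mult[of _ U0, symmetric] power_mult_distrib distrib_right[of _ _ "cmod U0"])
  qed
  moreover have "cmod (V0 + t *\<^sub>R l1 * U0) \<le> ?v + cmod (t *\<^sub>R l1 * U0)"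
    by (rule norm_triangle_ineq)
  moreover have "cmod (W0 + (2 * (t *\<^sub>R l1 * V0) + (t *\<^sub>R l2 + (t *\<^sub>R l1)\<^sup>2) * U0))
      \<le> ?w + (2 * cmod (t *\<^sub>R l1 * V0) + cmod ((t *\<^sub>R l2 + (t *\<^sub>R l1)\<^sup>2) * U0))"
    by (intro norm_triangle_le add_left_mono) (simp add: norm_mult[of 2])
  ultimately have
    "cmod U0 \<le> (1 + 4 * M * r + (2 * M)\<^sup>2 * r\<^sup>2) * X"
    "cmod (V0 + t *\<^sub>R l1 * U0) \<le> (1 + 4 * M * r + (2 * M)\<^sup>2 * r\<^sup>2) * X"
    "cmod (W0 + (2 * (t *\<^sub>R l1 * V0) + (t *\<^sub>R l2 + (t *\<^sub>R l1)\<^sup>2) * U0)) \<le> (1 + 4 * M * r + (2 * M)\<^sup>2 * r\<^sup>2) * X"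
    by linarith+
  then show "cmod (exp (t *\<^sub>R lam) * U0) \<le> P * X"
    and "cmod (exp (t *\<^sub>R lam) * (V0 + t *\<^sub>R l1 * U0)) \<le> P * X"
    and "cmod (exp (t *\<^sub>R lam) * (W0 + (2 * (t *\<^sub>R l1 * V0) + (t *\<^sub>R l2 + (t *\<^sub>R l1)\<^sup>2) * U0))) \<le> P * X"
    by (blast intro: main)+
qed

section \<open>The energy bound\<close>

text \<open>The set where the bound fails is open, and a nonempty open set is not null. Bounds at
  every single \<open>z\<close> are needed because the supremum over \<open>z\<close> is not an
  essential one.\<close>

lemma AE_bounded_continuous:
  fixes f :: "real \<Rightarrow> real"
  assumes "continuous_on UNIV f" "AE x in lebesgue. \<bar>f x\<bar> \<le> M"
  shows "\<bar>f x\<bar> \<le> M"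
proof (rule ccontr)
  assume "\<not> \<bar>f x\<bar> \<le> M"
  then have "{x. M < \<bar>f x\<bar>} \<noteq> {}"
    by (auto simp: not_le)
  moreover have "open {x. M < \<bar>f x\<bar>}"
    using assms(1) by (intro open_Collect_less continuous_intros)
  ultimately have "\<not> negligible {x. M < \<bar>f x\<bar>}"
    by (intro open_not_negligible)
  moreover obtain N where "N \<in> null_sets lebesgue" "{x. M < \<bar>f x\<bar>} \<subseteq> N"
    using assms(2) by (auto simp: eventually_ae_filter not_le)
  then have "negligible {x. M < \<bar>f x\<bar>}"
    using negligible_iff_null_sets negligible_subset by blast
  ultimately show False
    by blast
qed

lemma in_Linfty_bounded:
  assumes "in_Linfty f" "continuous_on UNIV f"
  obtains M where "\<And>x. \<bar>f x\<bar> \<le> M"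
  using assms AE_bounded_continuous unfolding in_Linfty_def by blast

lemma continuous_on_if_differentiable:
  "(\<And>z. f differentiable at z) \<Longrightarrow> continuous_on UNIV f" for f :: "real \<Rightarrow> real"
  by (simp add: continuous_at_imp_continuous_on differentiable_imp_continuous_within)

text \<open>Subtracting the steady state touches only mode 0, so for \<open>k \<ge> 1\<close> the
  ODEs for \<open>u\<close> directly describe \<open>u - 1\<close>.\<close>

lemma fourier_coeff_diff_const:
  assumes "in_L2 f"
  shows "fourier_coeff (\<lambda>x. f x - c) k = fourier_coeff f k - (if k = 0 then of_real (2 * pi * c) else 0)"
proof -
  have int: "integrable torus (\<lambda>x. f x * cos (real k * x))" "integrable torus (\<lambda>x. f x * sin (real k * x))"
    using assms by (auto intro!: integrable_mult_L2 in_L2_bounded[where B = 1] measurable_torus_continuous continuous_intros)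
  have "pairing (\<lambda>x. f x - c) (\<lambda>x. cos (real k * x)) =
      pairing f (\<lambda>x. cos (real k * x)) - c * (\<integral>x. cos (of_int (int k) * x) \<partial>torus)"
    using int(1) integrable_cos_torus[of "int k"] by (simp add: pairing_def left_diff_distrib)
  moreover have "pairing (\<lambda>x. f x - c) (\<lambda>x. sin (real k * x)) =
      pairing f (\<lambda>x. sin (real k * x)) - c * (\<integral>x. sin (of_int (int k) * x) \<partial>torus)"
    using int(2) integrable_sin_torus[of "int k"] by (simp add: pairing_def left_diff_distrib)
  ultimately show ?thesis
    by (simp only: integral_cos_torus integral_sin_torus) (auto simp: fourier_coeff_def complex_eq_iff)
qed

lemma fourier_coeff_0: "fourier_coeff f 0 = of_real (\<integral>x. f x \<partial>torus)"
  by (simp add: fourier_coeff_def pairing_def complex_eq_iff)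

lemma L2norm_sq_vector3:
  assumes "in_L2 f" "in_L2 g" "in_L2 h"
  shows "L2norm_sq (\<lambda>x. vector [f x, g x, h x] - vector [1, 0, 0]) =
    ennreal ((\<integral>x. (f x - 1)\<^sup>2 \<partial>torus) + (\<integral>x. (g x)\<^sup>2 \<partial>torus) + (\<integral>x. (h x)\<^sup>2 \<partial>torus))"
proof -
  have eq: "(norm (vector [f x, g x, h x] - vector [1, 0, 0] :: real ^ 3))\<^sup>2 = (f x - 1)\<^sup>2 + (g x)\<^sup>2 + (h x)\<^sup>2" for x
    unfolding power2_norm_eq_inner by (simp add: inner_vec_def sum_3 power2_eq_square)
  have int: "integrable torus (\<lambda>x. (f x - 1)\<^sup>2)" "integrable torus (\<lambda>x. (g x)\<^sup>2)" "integrable torus (\<lambda>x. (h x)\<^sup>2)"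
    using assms in_L2_diff[OF assms(1) in_L2_one] by (auto simp: in_L2_def)
  have "L2norm_sq (\<lambda>x. vector [f x, g x, h x] - vector [1, 0, 0]) =
      ennreal (\<integral>x. (f x - 1)\<^sup>2 + (g x)\<^sup>2 + (h x)\<^sup>2 \<partial>torus)"
    unfolding L2norm_sq_def eq using int by (intro nn_integral_eq_integral) auto
  then show ?thesis
    using int by simp
qed

lemma sum3_power2_le:
  fixes x y z :: real
  shows "(x + y + z)\<^sup>2 \<le> 3 * (x\<^sup>2 + y\<^sup>2 + z\<^sup>2)"
  using zero_le_power2[of "x - y"] zero_le_power2[of "y - z"] zero_le_power2[of "x - z"]
  by (simp add: power2_eq_square algebra_simps)

lemma one_plus_power4_le:
  assumes "0 \<le> (t :: real)"
  shows "(1 + t) ^ 4 \<le> 8 * (1 + t ^ 4)"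
proof -
  have sq: "(x + y)\<^sup>2 \<le> 2 * (x\<^sup>2 + y\<^sup>2)" for x y :: real
    using zero_le_power2[of "x - y"] by (simp add: power2_eq_square algebra_simps)
  have "(1 + t) ^ 4 = ((1 + t)\<^sup>2)\<^sup>2"
    by simp
  also have "\<dots> \<le> (2 * (1\<^sup>2 + t\<^sup>2))\<^sup>2"
    by (intro power_mono sq) auto
  also have "\<dots> = 4 * (1 + t\<^sup>2)\<^sup>2"
    unfolding power_mult_distrib by simp
  also have "\<dots> \<le> 4 * (2 * (1\<^sup>2 + (t\<^sup>2)\<^sup>2))"
    by (intro mult_left_mono sq) auto
  finally show ?thesis
    by simp
qed

lemma solution_energy_bound:
  assumes sol: "solves_system a b u v w" and norm: "normalized u v w"
    and "0 < b0" "b0 \<le> b z" "0 \<le> t"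
    and M: "\<bar>deriv a z\<bar> \<le> M" "\<bar>deriv b z\<bar> \<le> M" "\<bar>deriv (deriv a) z\<bar> \<le> M" "\<bar>deriv (deriv b) z\<bar> \<le> M"
  defines "Q \<equiv> \<lambda>t. (\<integral>x. (u x z t - 1)\<^sup>2 \<partial>torus) + (\<integral>x. (v x z t)\<^sup>2 \<partial>torus) + (\<integral>x. (w x z t)\<^sup>2 \<partial>torus)"
  shows "Q t \<le> 9 * (exp (- b0 * t) * (1 + 2 * M * (t + 2 / b0))\<^sup>2)\<^sup>2 * Q 0"
proof -
  define P where "P = exp (- b0 * t) * (1 + 2 * M * (t + 2 / b0))\<^sup>2"
  have L2: "in_L2 (\<lambda>x. u x z s)" "in_L2 (\<lambda>x. v x z s)" "in_L2 (\<lambda>x. w x z s)" if "0 \<le> s" for s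
    using sol that by (auto simp: solves_system_def)
  have L2': "in_L2 (\<lambda>x. u x z s - 1)" if "0 \<le> s" for s
    using in_L2_diff[OF L2(1)[OF that] in_L2_one] .
  define U where "U k s = fourier_coeff (\<lambda>x. u x z s) k" for k s
  define V where "V k s = fourier_coeff (\<lambda>x. v x z s) k" for k s
  define W where "W k s = fourier_coeff (\<lambda>x. w x z s) k" for k s
  define lam where "lam k = symbol (a z) (b z) k" for k
  define l1 where "l1 k = symbol (deriv a z) (deriv b z) k" for k
  define l2 where "l2 k = symbol (deriv (deriv a) z) (deriv (deriv b) z) k" for k
  have Complex_add: "Complex (x + x') (y + y') = Complex x y + Complex x' y'" for x x' y y'
    by (simp add: complex_eq_iff)
  have two_l1: "symbol (2 * deriv a z) (2 * deriv b z) k = 2 * l1 k" for k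
    by (simp add: l1_def symbol_def complex_eq_iff)
  have u: "evolves_by (\<lambda>t x. u x z t) (\<lambda>t \<phi>. conv_diff (a z) (b z) (\<lambda>x. u x z t) \<phi>)"
    and v: "evolves_by (\<lambda>t x. v x z t)
        (\<lambda>t \<phi>. conv_diff (deriv a z) (deriv b z) (\<lambda>x. u x z t) \<phi>
             + conv_diff (a z) (b z) (\<lambda>x. v x z t) \<phi>)"
    and w: "evolves_by (\<lambda>t x. w x z t)
        (\<lambda>t \<phi>. conv_diff (deriv (deriv a) z) (deriv (deriv b) z) (\<lambda>x. u x z t) \<phi>
             + conv_diff (2 * deriv a z) (2 * deriv b z) (\<lambda>x. v x z t) \<phi>
             + conv_diff (a z) (b z) (\<lambda>x. w x z t) \<phi>)"
    using sol by (auto simp: solves_system_def)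
  have cont: "continuous_on {0..} (U k)" "continuous_on {0..} (V k)" "continuous_on {0..} (W k)" for k
    unfolding U_def V_def W_def by (rule evolves_by_fourier(1), rule u v w)+
  have U': "(U k has_vector_derivative lam k * U k s) (at s)" if "s > 0" for k s
    using evolves_by_fourier(2)[OF u that, of k] unfolding conv_diff_fourier U_def[abs_def] lam_def .
  have V': "(V k has_vector_derivative l1 k * U k s + lam k * V k s) (at s)" if "s > 0" for k s
    using evolves_by_fourier(2)[OF v that, of k]
    unfolding Complex_add conv_diff_fourier U_def V_def[abs_def] lam_def l1_def .
  have W': "(W k has_vector_derivative l2 k * U k s + 2 * l1 k * V k s + lam k * W k s) (at s)"
    if "s > 0" for k s
    using evolves_by_fourier(2)[OF w that, of k]
    unfolding Complex_add conv_diff_fourier two_l1 U_def V_def W_def[abs_def] lam_def l2_def .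
  have explicit: "U k t = exp (t *\<^sub>R lam k) * U k 0"
    "V k t = exp (t *\<^sub>R lam k) * (V k 0 + t *\<^sub>R l1 k * U k 0)"
    "W k t = exp (t *\<^sub>R lam k) *
      (W k 0 + (2 * (t *\<^sub>R l1 k * V k 0) + (t *\<^sub>R l2 k + (t *\<^sub>R l1 k)\<^sup>2) * U k 0))" for k
    using triangular_system_solution[OF cont U' V' W' \<open>0 \<le> t\<close>] by blast+
  define A where "A k s = (cmod (fourier_coeff (\<lambda>x. u x z s - 1) k))\<^sup>2 + (cmod (V k s))\<^sup>2 + (cmod (W k s))\<^sup>2" for k s
  \<comment> \<open>All symbols vanish at \<open>k = 0\<close>, so the means are conserved; the mean
    \<open>2 * pi\<close> of \<open>u\<close> is cancelled by subtracting 1.\<close>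
  have A0: "A 0 s = 0" if "s \<in> {0, t}" for s
  proof -
    have "U 0 0 = of_real (2 * pi)" "V 0 0 = 0" "W 0 0 = 0"
      using norm by (simp_all add: normalized_def U_def V_def W_def fourier_coeff_0 field_simps)
    moreover from this have "U 0 t = of_real (2 * pi)" "V 0 t = 0" "W 0 t = 0"
      using explicit[of 0] by (simp_all add: lam_def l1_def l2_def symbol_def Complex_eq)
    ultimately show ?thesis
      using that \<open>0 \<le> t\<close> by (auto simp: A_def fourier_coeff_diff_const[OF L2(1)] U_def)
  qed
  have A_le: "A k t \<le> 9 * P\<^sup>2 * A k 0" if "k \<ge> 1" for k
  proof -
    define X where "X = cmod (U k 0) + cmod (V k 0) + cmod (W k 0)"
    have A: "A k s = (cmod (U k s))\<^sup>2 + (cmod (V k s))\<^sup>2 + (cmod (W k s))\<^sup>2" if "0 \<le> s" for s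
      using \<open>k \<ge> 1\<close> by (simp add: A_def fourier_coeff_diff_const[OF L2(1)[OF that]] U_def)
    have "0 \<le> M"
      using M(1) by linarith
    moreover have "Re (lam k) \<le> - b0 * (real k)\<^sup>2"
      using \<open>b0 \<le> b z\<close> by (auto simp: lam_def symbol_def intro: mult_right_mono)
    moreover have "cmod (l1 k) \<le> 2 * M * (real k)\<^sup>2" "cmod (l2 k) \<le> 2 * M * (real k)\<^sup>2"
      using M by (auto simp: l1_def l2_def intro: norm_symbol_le)
    ultimately have "cmod (U k t) \<le> P * X" "cmod (V k t) \<le> P * X" "cmod (W k t) \<le> P * X"
      unfolding explicit P_def X_def by (rule mode_bound[OF \<open>k \<ge> 1\<close> \<open>0 < b0\<close> \<open>0 \<le> t\<close>]; assumption)+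
    from this[THEN power_mono[OF _ norm_ge_zero, where n = 2]]
    \<comment> \<open>One factor 3 counts the components; the second comes from bounding the square
      of the three-term sum \<open>X\<close>. Together they give 9.\<close>
    have "A k t \<le> 3 * (P * X)\<^sup>2"
      using A[OF \<open>0 \<le> t\<close>] by linarith
    also have "\<dots> = 3 * P\<^sup>2 * X\<^sup>2"
      by (simp add: power_mult_distrib)
    also have "\<dots> \<le> 3 * P\<^sup>2 * (3 * A k 0)"
      unfolding A[OF order_refl] X_def by (intro mult_left_mono sum3_power2_le) auto
    finally show ?thesis
      by simp
  qed
  have lim: "(\<lambda>n. \<Sum>k=1..n. A k s / pi) \<longlonglongrightarrow> Q s" if s: "s \<in> {0, t}" for s
  proof -
    have "0 \<le> s"
      using s \<open>0 \<le> t\<close> by auto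
    note L = tendsto_add[OF tendsto_add[OF Parseval[OF L2'] Parseval[OF L2(2)]] Parseval[OF L2(3)], OF \<open>0 \<le> s\<close> \<open>0 \<le> s\<close> \<open>0 \<le> s\<close>]
    \<comment> \<open>Mode 0 has its own weight in Parseval's identity and must vanish before the
      rest combines into sums of \<open>A k s / pi\<close>.\<close>
    have z: "fourier_coeff (\<lambda>x. u x z s - 1) 0 = 0" "V 0 s = 0" "W 0 s = 0"
      using A0[OF s] unfolding A_def by (auto simp: add_nonneg_eq_0_iff)
    have "(\<lambda>n. \<Sum>k=1..n. A k s / pi) \<longlonglongrightarrow> (\<integral>x. (u x z s - 1)\<^sup>2 \<partial>torus) + (\<integral>x. (v x z s)\<^sup>2 \<partial>torus) + (\<integral>x. (w x z s)\<^sup>2 \<partial>torus)"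
      using L z by (simp add: A_def V_def W_def sum.distrib add_divide_distrib)
    then show ?thesis
      by (simp add: Q_def)
  qed
  have "(\<lambda>n. 9 * P\<^sup>2 * (\<Sum>k=1..n. A k 0 / pi)) \<longlonglongrightarrow> 9 * P\<^sup>2 * Q 0"
    by (intro tendsto_intros lim) simp
  with lim[of t] have "Q t \<le> 9 * P\<^sup>2 * Q 0"
  proof (rule LIMSEQ_le)
    have "(\<Sum>k=1..n. A k t / pi) \<le> 9 * P\<^sup>2 * (\<Sum>k=1..n. A k 0 / pi)" for n
      unfolding sum_distrib_left using A_le by (intro sum_mono) (simp add: divide_right_mono)
    then show "\<exists>N. \<forall>n\<ge>N. (\<Sum>k=1..n. A k t / pi) \<le> 9 * P\<^sup>2 * (\<Sum>k=1..n. A k 0 / pi)"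
      by blast
  qed simp
  then show ?thesis
    by (simp add: P_def)
qed

theorem theorem3p3:
  fixes a b :: "real \<Rightarrow> real" and b0 :: real
  assumes "C2 a" and "C2 b"
    and "b0 = (INF z. b z)" and "b0 > 0"
    and "in_Linfty b"
    and "in_Linfty (deriv a)" and "in_Linfty (deriv b)"
    and "in_Linfty (deriv (deriv a))" and "in_Linfty (deriv (deriv b))"
  shows "\<exists>C>0. \<forall>u v w :: real \<Rightarrow> real \<Rightarrow> real \<Rightarrow> real.
    solves_system a b u v w \<and> normalized u v w \<longrightarrow>
    (\<forall>t\<ge>0.
      (SUP z. L2norm_sq (\<lambda>x. vector [u x z t, v x z t, w x z t] - vector [1, 0, 0]))
      \<le> ennreal (C * (1 + t ^ 4) * exp (- 2 * b0 * t)) *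
        (SUP z. L2norm_sq (\<lambda>x. vector [u x z 0, v x z 0, w x z 0] - vector [1, 0, 0])))"
proof -
  have cont: "continuous_on UNIV b" "continuous_on UNIV (deriv a)" "continuous_on UNIV (deriv b)"
    "continuous_on UNIV (deriv (deriv a))" "continuous_on UNIV (deriv (deriv b))"
    using assms(1,2) by (auto simp: C2_def intro: continuous_on_if_differentiable)
  obtain B where B: "\<And>z. \<bar>b z\<bar> \<le> B"
    using in_Linfty_bounded[OF assms(5) cont(1)] by blast
  \<comment> \<open>A real \<open>INF\<close> is a genuine lower bound only for a set bounded
    below.\<close>
  have "bdd_below (range b)"
    using B by (intro bdd_belowI2[of _ "- B"]) (auto simp: abs_le_iff minus_le_iff)
  then have b0: "b0 \<le> b z" for z
    unfolding assms(3) by (intro cINF_lower) auto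
  obtain M1 where M1: "\<And>z. \<bar>deriv a z\<bar> \<le> M1"
    using in_Linfty_bounded[OF assms(6) cont(2)] by blast
  obtain M2 where M2: "\<And>z. \<bar>deriv b z\<bar> \<le> M2"
    using in_Linfty_bounded[OF assms(7) cont(3)] by blast
  obtain M3 where M3: "\<And>z. \<bar>deriv (deriv a) z\<bar> \<le> M3"
    using in_Linfty_bounded[OF assms(8) cont(4)] by blast
  obtain M4 where M4: "\<And>z. \<bar>deriv (deriv b) z\<bar> \<le> M4"
    using in_Linfty_bounded[OF assms(9) cont(5)] by blast
  define M where "M = Max {M1, M2, M3, M4}"
  have M: "\<bar>deriv a z\<bar> \<le> M" "\<bar>deriv b z\<bar> \<le> M" "\<bar>deriv (deriv a) z\<bar> \<le> M" "\<bar>deriv (deriv b) z\<bar> \<le> M" for z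
    using M1[of z] M2[of z] M3[of z] M4[of z] by (auto simp: M_def le_max_iff_disj)
  have "0 \<le> M"
    using M(1)[of 0] by linarith
  \<comment> \<open>Chosen so that \<open>1 + 2 * M * (t + 2 / b0)\<close>, which is
    \<open>1 + 4 * M / b0 + 2 * M * t\<close>, is at most \<open>D * (1 + t)\<close>.\<close>
  define D where "D = 1 + 4 * M / b0 + 2 * M"
  have "0 < D"
    using \<open>0 \<le> M\<close> \<open>b0 > 0\<close> by (auto simp: D_def intro!: add_pos_nonneg)
  \<comment> \<open>\<open>72 = 9 * 8\<close>: the 9 of the energy bound times the 8 from
    \<open>(1 + t) ^ 4 \<le> 8 * (1 + t ^ 4)\<close>.\<close>
  define C where "C = 72 * D ^ 4"
  show ?thesis
  proof (intro exI[of _ C] conjI allI impI)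
    show "C > 0"
      using \<open>0 < D\<close> by (simp add: C_def)
    fix u v w :: "real \<Rightarrow> real \<Rightarrow> real \<Rightarrow> real" and t :: real
    assume sol: "solves_system a b u v w \<and> normalized u v w" and "0 \<le> t"
    define Q where "Q z s = (\<integral>x. (u x z s - 1)\<^sup>2 \<partial>torus) + (\<integral>x. (v x z s)\<^sup>2 \<partial>torus) + (\<integral>x. (w x z s)\<^sup>2 \<partial>torus)" for z s
    have L2norm: "L2norm_sq (\<lambda>x. vector [u x z s, v x z s, w x z s] - vector [1, 0, 0]) = ennreal (Q z s)"
      if "0 \<le> s" for z s
      unfolding Q_def using sol that by (intro L2norm_sq_vector3) (auto simp: solves_system_def)
    have Q_nonneg: "0 \<le> Q z s" for z s
      unfolding Q_def by (intro add_nonneg_nonneg integral_nonneg_AE) auto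
    have factor: "9 * (exp (- b0 * t) * (1 + 2 * M * (t + 2 / b0))\<^sup>2)\<^sup>2 \<le> C * (1 + t ^ 4) * exp (- 2 * b0 * t)"
    proof -
      have "1 + 2 * M * (t + 2 / b0) \<le> D * (1 + t)"
      proof -
        have "D * (1 + t) - (1 + 2 * M * (t + 2 / b0)) = t + 4 * M / b0 * t + 2 * M"
          by (simp add: D_def algebra_simps add_divide_distrib)
        moreover have "0 \<le> 4 * M / b0 * t"
          using \<open>0 \<le> M\<close> \<open>b0 > 0\<close> \<open>0 \<le> t\<close> by simp
        ultimately show ?thesis
          using \<open>0 \<le> M\<close> \<open>0 \<le> t\<close> by linarith
      qed
      then have "(1 + 2 * M * (t + 2 / b0)) ^ 4 \<le> (D * (1 + t)) ^ 4"
        using \<open>0 \<le> M\<close> \<open>b0 > 0\<close> \<open>0 \<le> t\<close> by (intro power_mono) auto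
      also have "\<dots> \<le> D ^ 4 * (8 * (1 + t ^ 4))"
        unfolding power_mult_distrib using one_plus_power4_le[OF \<open>0 \<le> t\<close>] \<open>0 < D\<close> by (intro mult_left_mono) auto
      finally have "9 * exp (- 2 * b0 * t) * (1 + 2 * M * (t + 2 / b0)) ^ 4
          \<le> 9 * exp (- 2 * b0 * t) * (D ^ 4 * (8 * (1 + t ^ 4)))"
        by (intro mult_left_mono) auto
      moreover have "9 * (exp (- b0 * t) * y\<^sup>2)\<^sup>2 = 9 * exp (- 2 * b0 * t) * y ^ 4" for y
        by (simp add: power_mult_distrib exp_double[symmetric])
      ultimately show ?thesis
        unfolding C_def by (simp only:) (simp add: algebra_simps)
    qed
    show "(SUP z. L2norm_sq (\<lambda>x. vector [u x z t, v x z t, w x z t] - vector [1, 0, 0]))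
      \<le> ennreal (C * (1 + t ^ 4) * exp (- 2 * b0 * t)) *
        (SUP z. L2norm_sq (\<lambda>x. vector [u x z 0, v x z 0, w x z 0] - vector [1, 0, 0]))"
      unfolding L2norm[OF \<open>0 \<le> t\<close>] L2norm[OF order_refl]
    \<comment> \<open>The estimate holds for each \<open>z\<close> with a factor free of
      \<open>z\<close>; working in \<open>ennreal\<close> also covers an infinite supremum of the
      initial norms.\<close>
    proof (rule SUP_least)
      fix z
      have "Q z t \<le> 9 * (exp (- b0 * t) * (1 + 2 * M * (t + 2 / b0))\<^sup>2)\<^sup>2 * Q z 0"
        unfolding Q_def using sol b0 M \<open>b0 > 0\<close> \<open>0 \<le> t\<close> by (intro solution_energy_bound) auto
      also have "\<dots> \<le> C * (1 + t ^ 4) * exp (- 2 * b0 * t) * Q z 0"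
        by (intro mult_right_mono factor Q_nonneg)
      finally have "ennreal (Q z t) \<le> ennreal (C * (1 + t ^ 4) * exp (- 2 * b0 * t)) * ennreal (Q z 0)"
        using \<open>0 < D\<close> Q_nonneg by (simp add: C_def ennreal_mult[symmetric] ennreal_leI)
      also have "\<dots> \<le> ennreal (C * (1 + t ^ 4) * exp (- 2 * b0 * t)) * (SUP z. ennreal (Q z 0))"
        by (intro mult_left_mono SUP_upper) auto
      finally show "ennreal (Q z t) \<le> ennreal (C * (1 + t ^ 4) * exp (- 2 * b0 * t)) * (SUP z. ennreal (Q z 0))" .
    qed
  qed
qed

end
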